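(* Let $G$ be an ample Hausdorff groupoid, let $R$ be a unital commutative ring and let $\Gamma$ be a discrete group with identity $\epsilon$. Suppose that $(\Sigma, G, \Gamma)$ is a graded discrete $R$-twist and that the subgroupoid $G_\epsilon$ is effective. If $Q$ is a $\Gamma$-graded ring and $\pi:A_R(G;\Sigma) \to Q$ is a graded ring homomorphism, then $\pi$ is injective if and only if $\pi(r\tilde{1}_K) \neq 0$ for every nonempty compact open subset $K$ of $\Sigma^{(0)}$ and every $r \in R\setminus\{0\}$.
   Context: A topological groupoid $G$ (range $r(\alpha)=\alpha\alpha^{-1}$, source $s(\alpha)=\alpha^{-1}\alpha$, unit space $G^{(0)}=r(G)=s(G)$) is étale if $s$ (equivalently $r$) is a local homeomorphism. An open subset $U\subseteq G$ is an open bisection if $r|_U$ and $s|_U$ are homeomorphisms onto open subsets of $G^{(0)}$. An étale groupoid is ample if it has a basis of compact open bisections. $\mathrm{Iso}(G)=\{\gamma\in G: r(\gamma)=s(\gamma)\}$, $\mathrm{Iso}(G)^\circ$ is its topological interior in $G$, and $G$ is effective if $\mathrm{Iso}(G)^\circ=G^{(0)}$. Discrete twist: let $R^\times$ be the group of units of $R$ with the discrete topology. A discrete twist $(\Sigma,i,q)$ by $R^\times$ (discrete $R$-twist) over an ample Hausdorff groupoid $G$ is a sequence $G^{(0)}\times R^\times \xrightarrow{i}\Sigma\xrightarrow{q} G$, where $G^{(0)}\times R^\times$ is the trivial group bundle with fibres $R^\times$, $\Sigma$ is a Hausdorff étale groupoid with $\Sigma^{(0)}=i(G^{(0)}\times\{1\})$,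 and $i,q$ are continuous groupoid homomorphisms restricting to homeomorphisms of unit spaces, such that: (DT1) $i(\{x\}\times R^\times)=q^{-1}(x)$ for every $x\in G^{(0)}$, $i$ is injective, $q$ is surjective; (DT2) for each $\alpha\in G$ there are an open bisection $B_\alpha\ni\alpha$ of $G$ and a continuous map $P_\alpha:B_\alpha\to\Sigma$ with $q\circ P_\alpha=\mathrm{id}_{B_\alpha}$ such that $(\beta,t)\mapsto i(r(\beta),t)P_\alpha(\beta)$ is a homeomorphism from $B_\alpha\times R^\times$ onto $q^{-1}(B_\alpha)$; (DT3) $i(r(\sigma),t)\sigma=\sigma\, i(s(\sigma),t)$ for all $\sigma\in\Sigma$, $t\in R^\times$ (identifying $\Sigma^{(0)}$ with $G^{(0)}$ via $q$). $R^\times$ acts on $\Sigma$ by $t\cdot\sigma=i(r(\sigma),t)\sigma$. Twisted Steinberg algebra: $A_R(G;\Sigma)$ is the $R$-module of locally constant functions $f:\Sigma\to R$ that are $R^\times$-contravariant, i.e. $f(t\cdot\sigma)=t^{-1}f(\sigma)$, and for which $\mathrm{supp}_G(f):=q(\mathrm{supp}(f))$ is compact, where $\mathrm{supp}(f)=\{\sigma: f(\sigma)\neq0\}$. Its product is $(f*g)(\sigma)=\sum_{\alpha} f(S(\alpha))\,g(S(\alpha)^{-1}\sigma)$, the sum over $\alpha\in \mathrm{supp}_G(f)$ with $r(\alpha)=r(q(\sigma))$, where $S:G\to\Sigma$ is any (not necessarily continuous) section of $q$; the product is independent of $S$. For a compact open bisection $X\subseteq\Sigma$, $\tilde 1_X\in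 A_R(G;\Sigma)$ is the function with $\tilde 1_X(\sigma)=t^{-1}$ if $\sigma\in t\cdot X$ for some $t\in R^\times$, and $\tilde 1_X(\sigma)=0$ otherwise. Gradings: a graded discrete $R$-twist $(\Sigma,G,\Gamma)$ is a discrete twist $(\Sigma,i,q)$ by $R^\times$ over $G$ together with continuous groupoid homomorphisms $c_\Sigma:\Sigma\to\Gamma$ and $c_G:G\to\Gamma$ with $c_\Sigma=c_G\circ q$. Put $G_\gamma=c_G^{-1}(\gamma)$ ($G_\epsilon$ is a clopen subgroupoid of $G$). Then $A_R(G;\Sigma)$ is $\Gamma$-graded with homogeneous components $A_R(G;\Sigma)_\gamma=\{f: \mathrm{supp}_G(f)\subseteq G_\gamma\}$. A graded ring homomorphism is a ring homomorphism (not necessarily unital) mapping the degree-$\gamma$ component into the degree-$\gamma$ component for each $\gamma\in\Gamma$. *)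

theory Defs
  imports
    "HOL-Analysis.Product_Topology"
    "HOL-Analysis.T1_Spaces"
    "HOL-Algebra.Module"
begin

section \<open>Topological groupoids\<close>

text \<open>
  The arrows of a groupoid are the points of its topology; \<open>composable\<close> is the set of
  composable pairs. Values of \<open>\<star>\<close> off \<open>composable\<close> and of \<open>ginv\<close> off
  the arrows are irrelevant.
\<close>

record 'g groupoid =
  gtop :: "'g topology"
  composable :: "('g \<times> 'g) set"
  gmult :: "'g \<Rightarrow> 'g \<Rightarrow> 'g"  (infixl \<open>\<star>\<index>\<close> 70)
  ginv :: "'g \<Rightarrow> 'g"

abbreviation arrows :: "('g, 'm) groupoid_scheme \<Rightarrow> 'g set" where
  "arrows G \<equiv> topspace (gtop G)"

definition range_of :: "('g, 'm) groupoid_scheme \<Rightarrow> 'g \<Rightarrow> 'g" where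
  "range_of G a = a \<star>\<^bsub>G\<^esub> ginv G a"

definition source_of :: "('g, 'm) groupoid_scheme \<Rightarrow> 'g \<Rightarrow> 'g" where
  "source_of G a = ginv G a \<star>\<^bsub>G\<^esub> a"

definition unit_space :: "('g, 'm) groupoid_scheme \<Rightarrow> 'g set" where
  "unit_space G = range_of G ` arrows G"

abbreviation unit_topology :: "('g, 'm) groupoid_scheme \<Rightarrow> 'g topology" where
  "unit_topology G \<equiv> subtopology (gtop G) (unit_space G)"

text \<open>The algebraic axioms are those of Hahn and Renault.\<close>

locale topological_groupoid =
  fixes G (structure)
  assumes composable_subset: "composable G \<subseteq> arrows G \<times> arrows G"
    and mult_closed: "(a, b) \<in> composable G \<Longrightarrow> a \<star> b \<in> arrows G"
    and inv_closed: "a \<in> arrows G \<Longrightarrow> ginv G a \<in> arrows G"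
    and inv_inv: "a \<in> arrows G \<Longrightarrow> ginv G (ginv G a) = a"
    and assoc: "\<lbrakk>(a, b) \<in> composable G; (b, c) \<in> composable G\<rbrakk> \<Longrightarrow>
      (a \<star> b, c) \<in> composable G \<and> (a, b \<star> c) \<in> composable G \<and> (a \<star> b) \<star> c = a \<star> (b \<star> c)"
    and inv_composable: "a \<in> arrows G \<Longrightarrow> (a, ginv G a) \<in> composable G"
    and cancel_left: "(a, b) \<in> composable G \<Longrightarrow> ginv G a \<star> (a \<star> b) = b"
    and cancel_right: "(a, b) \<in> composable G \<Longrightarrow> (a \<star> b) \<star> ginv G b = a"
    and continuous_mult:
      "continuous_map (subtopology (prod_topology (gtop G) (gtop G)) (composable G)) (gtop G)
         (\<lambda>(a, b). a \<star> b)"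
    and continuous_inv: "continuous_map (gtop G) (gtop G) (ginv G)"

definition local_homeomorphism :: "'a topology \<Rightarrow> 'b topology \<Rightarrow> ('a \<Rightarrow> 'b) \<Rightarrow> bool" where
  "local_homeomorphism X Y f \<longleftrightarrow>
     (\<forall>x \<in> topspace X. \<exists>U. openin X U \<and> x \<in> U \<and> openin Y (f ` U) \<and>
        homeomorphic_map (subtopology X U) (subtopology Y (f ` U)) f)"

locale etale_groupoid = topological_groupoid +
  assumes source_local_homeomorphism:
    "local_homeomorphism (gtop G) (unit_topology G) (source_of G)"

definition open_bisection :: "('g, 'm) groupoid_scheme \<Rightarrow> 'g set \<Rightarrow> bool" where
  "open_bisection G U \<longleftrightarrow> openin (gtop G) U \<and>
     (\<forall>f \<in> {range_of G, source_of G}. openin (unit_topology G) (f ` U) \<and>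
        homeomorphic_map (subtopology (gtop G) U) (subtopology (unit_topology G) (f ` U)) f)"

locale ample_groupoid = etale_groupoid +
  assumes compact_open_bisection_basis:
    "\<lbrakk>openin (gtop G) W; a \<in> W\<rbrakk> \<Longrightarrow>
       \<exists>B. open_bisection G B \<and> compactin (gtop G) B \<and> a \<in> B \<and> B \<subseteq> W"

definition isotropy :: "('g, 'm) groupoid_scheme \<Rightarrow> 'g set" where
  "isotropy G = {a \<in> arrows G. range_of G a = source_of G a}"

definition effective :: "('g, 'm) groupoid_scheme \<Rightarrow> bool" where
  "effective G \<longleftrightarrow> gtop G interior_of isotropy G = unit_space G"

definition restrict_groupoid :: "('g, 'm) groupoid_scheme \<Rightarrow> 'g set \<Rightarrow> 'g groupoid" where
  "restrict_groupoid G H =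
     \<lparr>gtop = subtopology (gtop G) H, composable = composable G \<inter> (H \<times> H),
      gmult = gmult G, ginv = ginv G\<rparr>"

definition continuous_groupoid_hom ::
    "('g, 'm) groupoid_scheme \<Rightarrow> ('h, 'n) groupoid_scheme \<Rightarrow> ('g \<Rightarrow> 'h) \<Rightarrow> bool" where
  "continuous_groupoid_hom G H f \<longleftrightarrow> continuous_map (gtop G) (gtop H) f \<and>
     (\<forall>(a, b) \<in> composable G. (f a, f b) \<in> composable H \<and> f (a \<star>\<^bsub>G\<^esub> b) = f a \<star>\<^bsub>H\<^esub> f b)"

definition discrete_group_groupoid :: "('c, 'm) monoid_scheme \<Rightarrow> 'c groupoid" where
  "discrete_group_groupoid \<Gamma> =
     \<lparr>gtop = discrete_topology (carrier \<Gamma>), composable = carrier \<Gamma> \<times> carrier \<Gamma>,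
      gmult = mult \<Gamma>, ginv = m_inv \<Gamma>\<rparr>"


section \<open>Discrete twists\<close>

definition trivial_bundle ::
    "('g, 'm) groupoid_scheme \<Rightarrow> ('r, 'n) ring_scheme \<Rightarrow> ('g \<times> 'r) groupoid" where
  "trivial_bundle G R =
     \<lparr>gtop = prod_topology (unit_topology G) (discrete_topology (Units R)),
      composable = {((x, t), (y, u)) | x t y u. x \<in> unit_space G \<and> y = x \<and> t \<in> Units R \<and> u \<in> Units R},
      gmult = (\<lambda>(x, t) (y, u). (x, t \<otimes>\<^bsub>R\<^esub> u)),
      ginv = (\<lambda>(x, t). (x, inv\<^bsub>R\<^esub> t))\<rparr>"

text \<open>
  The unit spaces of \<open>\<Sigma>\<close> and \<open>G\<close> are identified along \<open>q\<close>, so that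
  the expression \<open>i (r \<sigma>, t)\<close> of informal mathematics is
  \<open>i (q (range_of \<Sigma> \<sigma>), t)\<close>.
\<close>

locale discrete_twist = \<Sigma>: etale_groupoid \<Sigma>
  for G :: "('g, 'm) groupoid_scheme" and R :: "('r, 'n) ring_scheme"
    and \<Sigma> :: "('s, 'k) groupoid_scheme" and i :: "'g \<times> 'r \<Rightarrow> 's" and q :: "'s \<Rightarrow> 'g" +
  assumes Hausdorff: "Hausdorff_space (gtop \<Sigma>)"
    and unit_space_eq: "unit_space \<Sigma> = i ` (unit_space G \<times> {\<one>\<^bsub>R\<^esub>})"
    and i_hom: "continuous_groupoid_hom (trivial_bundle G R) \<Sigma> i"
    and q_hom: "continuous_groupoid_hom \<Sigma> G q"
    and i_units: "homeomorphic_map (unit_topology (trivial_bundle G R)) (unit_topology \<Sigma>) i"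
    and q_units: "homeomorphic_map (unit_topology \<Sigma>) (unit_topology G) q"
    and fibre: "x \<in> unit_space G \<Longrightarrow> i ` ({x} \<times> Units R) = {\<sigma> \<in> arrows \<Sigma>. q \<sigma> = x}"
    and i_inj: "inj_on i (unit_space G \<times> Units R)"
    and q_surj: "q ` arrows \<Sigma> = arrows G"
    and local_triviality: "\<alpha> \<in> arrows G \<Longrightarrow>
      \<exists>B P. open_bisection G B \<and> \<alpha> \<in> B \<and>
        continuous_map (subtopology (gtop G) B) (gtop \<Sigma>) P \<and> (\<forall>\<beta> \<in> B. q (P \<beta>) = \<beta>) \<and>
        homeomorphic_map
          (prod_topology (subtopology (gtop G) B) (discrete_topology (Units R)))
          (subtopology (gtop \<Sigma>) {\<sigma> \<in> arrows \<Sigma>. q \<sigma> \<in> B})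
          (\<lambda>(\<beta>, t). i (range_of G \<beta>, t) \<star>\<^bsub>\<Sigma>\<^esub> P \<beta>)"
    and central: "\<lbrakk>\<sigma> \<in> arrows \<Sigma>; t \<in> Units R\<rbrakk> \<Longrightarrow>
      i (q (range_of \<Sigma> \<sigma>), t) \<star>\<^bsub>\<Sigma>\<^esub> \<sigma> = \<sigma> \<star>\<^bsub>\<Sigma>\<^esub> i (q (source_of \<Sigma> \<sigma>), t)"

definition twist_action ::
    "('s, 'k) groupoid_scheme \<Rightarrow> ('g \<times> 'r \<Rightarrow> 's) \<Rightarrow> ('s \<Rightarrow> 'g) \<Rightarrow> 'r \<Rightarrow> 's \<Rightarrow> 's" where
  "twist_action \<Sigma> i q t \<sigma> = i (q (range_of \<Sigma> \<sigma>), t) \<star>\<^bsub>\<Sigma>\<^esub> \<sigma>"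

locale graded_discrete_twist =
  discrete_twist G R \<Sigma> i q
  for G :: "('g, 'm) groupoid_scheme" and R :: "('r, 'n) ring_scheme"
    and \<Sigma> :: "('s, 'k) groupoid_scheme" and i q
    and \<Gamma> :: "('c, 'l) monoid_scheme" and cG :: "'g \<Rightarrow> 'c" and c\<Sigma> :: "'s \<Rightarrow> 'c" +
  assumes cG_hom: "continuous_groupoid_hom G (discrete_group_groupoid \<Gamma>) cG"
    and c\<Sigma>_hom: "continuous_groupoid_hom \<Sigma> (discrete_group_groupoid \<Gamma>) c\<Sigma>"
    and c\<Sigma>_eq: "\<sigma> \<in> arrows \<Sigma> \<Longrightarrow> c\<Sigma> \<sigma> = cG (q \<sigma>)"

definition degree_part :: "('g, 'm) groupoid_scheme \<Rightarrow> ('g \<Rightarrow> 'c) \<Rightarrow> 'c \<Rightarrow> 'g set" where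
  "degree_part G cG \<gamma> = {\<alpha> \<in> arrows G. cG \<alpha> = \<gamma>}"


section \<open>Twisted Steinberg algebras\<close>

definition suppG ::
    "('r, 'n) ring_scheme \<Rightarrow> ('s, 'k) groupoid_scheme \<Rightarrow> ('s \<Rightarrow> 'g) \<Rightarrow> ('s \<Rightarrow> 'r) \<Rightarrow> 'g set" where
  "suppG R \<Sigma> q f = q ` {\<sigma> \<in> arrows \<Sigma>. f \<sigma> \<noteq> \<zero>\<^bsub>R\<^esub>}"

definition locally_constant :: "'a topology \<Rightarrow> ('a \<Rightarrow> 'b) \<Rightarrow> bool" where
  "locally_constant X f \<longleftrightarrow>
     (\<forall>x \<in> topspace X. \<exists>U. openin X U \<and> x \<in> U \<and> (\<forall>y \<in> U. f y = f x))"

definition steinberg_functions ::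
    "('g, 'm) groupoid_scheme \<Rightarrow> ('r, 'n) ring_scheme \<Rightarrow> ('s, 'k) groupoid_scheme \<Rightarrow>
     ('g \<times> 'r \<Rightarrow> 's) \<Rightarrow> ('s \<Rightarrow> 'g) \<Rightarrow> ('s \<Rightarrow> 'r) set" where
  "steinberg_functions G R \<Sigma> i q =
     {f \<in> arrows \<Sigma> \<rightarrow>\<^sub>E carrier R.
        locally_constant (gtop \<Sigma>) f \<and>
        (\<forall>t \<in> Units R. \<forall>\<sigma> \<in> arrows \<Sigma>. f (twist_action \<Sigma> i q t \<sigma>) = inv\<^bsub>R\<^esub> t \<otimes>\<^bsub>R\<^esub> f \<sigma>) \<and>
        compactin (gtop G) (suppG R \<Sigma> q f)}"

text \<open>
  The section of \<open>q\<close> is chosen by \<open>inv_into\<close>; for functions in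
  \<open>steinberg_functions\<close> the product does not depend on this choice.
\<close>

definition convolution ::
    "('g, 'm) groupoid_scheme \<Rightarrow> ('r, 'n) ring_scheme \<Rightarrow> ('s, 'k) groupoid_scheme \<Rightarrow>
     ('s \<Rightarrow> 'g) \<Rightarrow> ('s \<Rightarrow> 'r) \<Rightarrow> ('s \<Rightarrow> 'r) \<Rightarrow> 's \<Rightarrow> 'r" where
  "convolution G R \<Sigma> q f g =
     (\<lambda>\<sigma> \<in> arrows \<Sigma>.
        let S = inv_into (arrows \<Sigma>) q in
        \<Oplus>\<^bsub>R\<^esub>\<alpha> \<in> {\<alpha> \<in> suppG R \<Sigma> q f. range_of G \<alpha> = range_of G (q \<sigma>)}.
          f (S \<alpha>) \<otimes>\<^bsub>R\<^esub> g (ginv \<Sigma> (S \<alpha>) \<star>\<^bsub>\<Sigma>\<^esub> \<sigma>))"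

text \<open>
  The algebra has no multiplicative identity in general, so the \<open>one\<close> field of the
  record carries no information.
\<close>

definition twisted_steinberg_algebra ::
    "('g, 'm) groupoid_scheme \<Rightarrow> ('r, 'n) ring_scheme \<Rightarrow> ('s, 'k) groupoid_scheme \<Rightarrow>
     ('g \<times> 'r \<Rightarrow> 's) \<Rightarrow> ('s \<Rightarrow> 'g) \<Rightarrow> ('r, 's \<Rightarrow> 'r) module" where
  "twisted_steinberg_algebra G R \<Sigma> i q =
     \<lparr>carrier = steinberg_functions G R \<Sigma> i q,
      mult = convolution G R \<Sigma> q,
      one = undefined,
      zero = (\<lambda>\<sigma> \<in> arrows \<Sigma>. \<zero>\<^bsub>R\<^esub>),
      add = (\<lambda>f g. \<lambda>\<sigma> \<in> arrows \<Sigma>. f \<sigma> \<oplus>\<^bsub>R\<^esub> g \<sigma>),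
      smult = (\<lambda>r f. \<lambda>\<sigma> \<in> arrows \<Sigma>. r \<otimes>\<^bsub>R\<^esub> f \<sigma>)\<rparr>"

definition steinberg_component ::
    "('g, 'm) groupoid_scheme \<Rightarrow> ('r, 'n) ring_scheme \<Rightarrow> ('s, 'k) groupoid_scheme \<Rightarrow>
     ('g \<times> 'r \<Rightarrow> 's) \<Rightarrow> ('s \<Rightarrow> 'g) \<Rightarrow> ('g \<Rightarrow> 'c) \<Rightarrow> 'c \<Rightarrow> ('s \<Rightarrow> 'r) set" where
  "steinberg_component G R \<Sigma> i q cG \<gamma> =
     {f \<in> steinberg_functions G R \<Sigma> i q. suppG R \<Sigma> q f \<subseteq> degree_part G cG \<gamma>}"

text \<open>
  When \<open>X\<close> is a compact open bisection of the total groupoid of a twist, the scalar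
  described below is unique.
\<close>

definition tilde_indicator ::
    "('r, 'n) ring_scheme \<Rightarrow> ('s, 'k) groupoid_scheme \<Rightarrow> ('g \<times> 'r \<Rightarrow> 's) \<Rightarrow> ('s \<Rightarrow> 'g) \<Rightarrow>
     's set \<Rightarrow> 's \<Rightarrow> 'r" where
  "tilde_indicator R \<Sigma> i q X =
     (\<lambda>\<sigma> \<in> arrows \<Sigma>.
        if \<exists>t \<in> Units R. \<sigma> \<in> twist_action \<Sigma> i q t ` X
        then inv\<^bsub>R\<^esub> (THE t. t \<in> Units R \<and> \<sigma> \<in> twist_action \<Sigma> i q t ` X)
        else \<zero>\<^bsub>R\<^esub>)"


section \<open>Graded rings\<close>

text \<open>
  Graded rings need not be unital, hence the library locale \<open>ring\<close> does not apply; the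
  \<open>one\<close> field of the record is ignored.
\<close>

locale nonunital_ring = abelian_group Q for Q (structure) +
  assumes m_closed: "\<lbrakk>x \<in> carrier Q; y \<in> carrier Q\<rbrakk> \<Longrightarrow> x \<otimes> y \<in> carrier Q"
    and m_assoc: "\<lbrakk>x \<in> carrier Q; y \<in> carrier Q; z \<in> carrier Q\<rbrakk> \<Longrightarrow>
      (x \<otimes> y) \<otimes> z = x \<otimes> (y \<otimes> z)"
    and l_distr: "\<lbrakk>x \<in> carrier Q; y \<in> carrier Q; z \<in> carrier Q\<rbrakk> \<Longrightarrow>
      (x \<oplus> y) \<otimes> z = x \<otimes> z \<oplus> y \<otimes> z"
    and r_distr: "\<lbrakk>x \<in> carrier Q; y \<in> carrier Q; z \<in> carrier Q\<rbrakk> \<Longrightarrow>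
      z \<otimes> (x \<oplus> y) = z \<otimes> x \<oplus> z \<otimes> y"

locale graded_ring = nonunital_ring Q
  for \<Gamma> :: "('c, 'l) monoid_scheme" and Q :: "('q, 'm) ring_scheme" and Qc :: "'c \<Rightarrow> 'q set" +
  assumes component_subgroup: "\<gamma> \<in> carrier \<Gamma> \<Longrightarrow> subgroup (Qc \<gamma>) (add_monoid Q)"
    and component_mult: "\<lbrakk>\<gamma> \<in> carrier \<Gamma>; \<delta> \<in> carrier \<Gamma>; x \<in> Qc \<gamma>; y \<in> Qc \<delta>\<rbrakk> \<Longrightarrow>
      x \<otimes>\<^bsub>Q\<^esub> y \<in> Qc (\<gamma> \<otimes>\<^bsub>\<Gamma>\<^esub> \<delta>)"
    and direct_sum: "x \<in> carrier Q \<Longrightarrow>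
      \<exists>!f. f \<in> (\<Pi>\<^sub>E \<gamma> \<in> carrier \<Gamma>. Qc \<gamma>) \<and> finite {\<gamma> \<in> carrier \<Gamma>. f \<gamma> \<noteq> \<zero>\<^bsub>Q\<^esub>} \<and>
        x = (\<Oplus>\<^bsub>Q\<^esub>\<gamma> \<in> {\<gamma> \<in> carrier \<Gamma>. f \<gamma> \<noteq> \<zero>\<^bsub>Q\<^esub>}. f \<gamma>)"

text \<open>Unlike \<open>ring_hom\<close>, this does not ask for preservation of \<open>one\<close>.\<close>

definition graded_ring_hom ::
    "('c, 'l) monoid_scheme \<Rightarrow> ('a, 'm) ring_scheme \<Rightarrow> ('c \<Rightarrow> 'a set) \<Rightarrow>
     ('q, 'n) ring_scheme \<Rightarrow> ('c \<Rightarrow> 'q set) \<Rightarrow> ('a \<Rightarrow> 'q) set" where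
  "graded_ring_hom \<Gamma> A Ac Q Qc =
     {h \<in> hom (add_monoid A) (add_monoid Q) \<inter> hom A Q.
        \<forall>\<gamma> \<in> carrier \<Gamma>. h ` Ac \<gamma> \<subseteq> Qc \<gamma>}"

end

theory Submission
  imports Defs "HOL-Analysis.Abstract_Topological_Spaces"
begin

text \<open>
  If \<open>\<pi>\<close> is injective it cannot kill \<open>r\<one>\<^sub>K\<close>, since this function has the value
  \<open>r\<close> on \<open>K\<close> (here \<open>\<one>\<^sub>X\<close> stands for \<open>tilde_indicator R \<Sigma> i q X\<close>). The content is the converse:
  every nonzero kernel element \<open>f\<close> yields some \<open>r\<one>\<^sub>K\<close> with \<open>r\<close> nonzero and \<open>K\<close> nonempty
  that is also in the kernel.

  The restrictions of \<open>f\<close> to the clopen sets of constant degree have images in different components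
  of \<open>Q\<close>, and finitely many of them sum to \<open>f\<close>. So each of them is in the kernel
  (\<open>kernel_homogeneous\<close>), and \<open>f\<close> may be taken homogeneous. Let \<open>f \<sigma>\<^sub>0 = r \<noteq> 0\<close>. Multiplying on
  the left by \<open>\<one>\<^sub>X\<close>, for a compact open section \<open>X\<close> through \<open>\<sigma>\<^sub>0\<^sup>-\<^sup>1\<close>, moves \<open>f\<close> into the degree of
  the units and gives it the value \<open>r\<close> on a nonempty open set of units. Its support off the units
  is a compact set \<open>D\<close> in the open complement of the units in the identity component. That
  component being effective, no nonempty open subset of this complement consists of isotropy. So a
  bisection in it that has arrows with both ends in a given open set of units has one with distinct
  ends there, and the open set can be shrunk around one of these ends until no such arrow is left.
  Doing this for finitely many bisections that cover \<open>D\<close> leads to a nonempty open set of units that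
  contains both ends of no arrow in \<open>D\<close> (\<open>shrink_off_compact\<close>). Cutting down range and source to a compact
  open \<open>K\<close> inside that set removes all of \<open>D\<close> and leaves
  \<open>\<one>\<^sub>X * (f * \<one>\<^sub>K) = r\<one>\<^sub>K\<close> (\<open>compress_homogeneous\<close>), so \<open>\<pi>(r\<one>\<^sub>K) = 0\<close>.

  The bracketing matters: \<open>f * \<one>\<^sub>K\<close> is the restriction of \<open>f\<close> to a clopen set, so it lies in the
  algebra and multiplicativity of \<open>\<pi>\<close> applies to it, while the outer product is known explicitly.
\<close>

section \<open>Groupoid algebra from the Hahn--Renault axioms\<close>

context topological_groupoid
begin

lemma composable_arrows:
  assumes "(a, b) \<in> composable G"
  shows "a \<in> arrows G" "b \<in> arrows G"
  using assms composable_subset by auto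

lemma inv_composable':
  assumes "a \<in> arrows G"
  shows "(ginv G a, a) \<in> composable G"
  using inv_composable[OF inv_closed[OF assms]] inv_inv[OF assms] by simp

lemma range_closed [simp]: "a \<in> arrows G \<Longrightarrow> range_of G a \<in> arrows G"
  unfolding range_of_def by (rule mult_closed[OF inv_composable])

lemma source_closed [simp]: "a \<in> arrows G \<Longrightarrow> source_of G a \<in> arrows G"
  unfolding source_of_def by (rule mult_closed[OF inv_composable'])

lemma source_inv: "a \<in> arrows G \<Longrightarrow> source_of G (ginv G a) = range_of G a"
  unfolding range_of_def source_of_def by (simp add: inv_inv)

lemma range_inv: "a \<in> arrows G \<Longrightarrow> range_of G (ginv G a) = source_of G a"
  unfolding range_of_def source_of_def by (simp add: inv_inv)

lemma range_mult_self:
  assumes "a \<in> arrows G"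
  shows "(range_of G a, a) \<in> composable G" "range_of G a \<star> a = a"
  using assoc[OF inv_composable[OF assms] inv_composable'[OF assms]]
    cancel_right[OF inv_composable[OF assms]] inv_inv[OF assms]
  unfolding range_of_def by auto

lemma mult_source_self:
  assumes "a \<in> arrows G"
  shows "(a, source_of G a) \<in> composable G" "a \<star> source_of G a = a"
  using assoc[OF inv_composable[OF assms] inv_composable'[OF assms]]
    range_mult_self[OF assms]
  unfolding range_of_def source_of_def by auto

text \<open>
  The axioms leave \<open>composable\<close> abstract; cancellation forces it to be the fibre product
  over the units.
\<close>

lemma composable_imp_source_eq_range:
  assumes ab: "(a, b) \<in> composable G"
  shows "source_of G a = range_of G b"
proof -
  note a = composable_arrows(1)[OF ab]
  have c: "(source_of G a, b) \<in> composable G" "source_of G a \<star> b = b"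
    using assoc[OF inv_composable'[OF a] ab] cancel_left[OF ab] unfolding source_of_def by auto
  show ?thesis
    using cancel_right[OF c(1)] c(2) unfolding range_of_def by simp
qed

lemma composable_iff:
  assumes "a \<in> arrows G" "b \<in> arrows G"
  shows "(a, b) \<in> composable G \<longleftrightarrow> source_of G a = range_of G b"
proof
  assume eq: "source_of G a = range_of G b"
  have "(source_of G a, b) \<in> composable G"
    using range_mult_self(1)[OF assms(2)] eq by simp
  from assoc[OF mult_source_self(1)[OF assms(1)] this] show "(a, b) \<in> composable G"
    using mult_source_self(2)[OF assms(1)] by simp
qed (rule composable_imp_source_eq_range)

lemma range_mult:
  assumes ab: "(a, b) \<in> composable G"
  shows "range_of G (a \<star> b) = range_of G a"
proof -
  note a = composable_arrows(1)[OF ab]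
  have "(ginv G a, a \<star> b) \<in> composable G"
    using assoc[OF inv_composable'[OF a] ab] by simp
  from composable_imp_source_eq_range[OF this] show ?thesis
    using source_inv[OF a] by simp
qed

lemma source_mult:
  assumes ab: "(a, b) \<in> composable G"
  shows "source_of G (a \<star> b) = source_of G b"
proof -
  note b = composable_arrows(2)[OF ab]
  have "(a \<star> b, ginv G b) \<in> composable G"
    using assoc[OF ab inv_composable[OF b]] by simp
  from composable_imp_source_eq_range[OF this] show ?thesis
    using range_inv[OF b] by simp
qed

lemma range_range [simp]: "a \<in> arrows G \<Longrightarrow> range_of G (range_of G a) = range_of G a"
  using range_mult[OF inv_composable] by (simp add: range_of_def)

lemma source_range [simp]: "a \<in> arrows G \<Longrightarrow> source_of G (range_of G a) = range_of G a"
  using composable_imp_source_eq_range[OF range_mult_self(1)] by simp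

lemma source_source [simp]: "a \<in> arrows G \<Longrightarrow> source_of G (source_of G a) = source_of G a"
  using source_range[OF inv_closed] by (simp add: range_inv)

lemma range_unit: "a \<in> arrows G \<Longrightarrow> range_of G a \<in> unit_space G"
  unfolding unit_space_def by simp

lemma source_unit: "a \<in> arrows G \<Longrightarrow> source_of G a \<in> unit_space G"
  using range_unit[OF inv_closed] by (simp add: range_inv)

lemma unit_arrow: "x \<in> unit_space G \<Longrightarrow> x \<in> arrows G"
  unfolding unit_space_def by auto

lemma unit_space_subset: "unit_space G \<subseteq> arrows G"
  using unit_arrow by blast

lemma range_of_unit [simp]: "x \<in> unit_space G \<Longrightarrow> range_of G x = x"
  unfolding unit_space_def by auto

lemma source_of_unit [simp]: "x \<in> unit_space G \<Longrightarrow> source_of G x = x"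
  unfolding unit_space_def by auto

lemma unit_space_iff: "x \<in> unit_space G \<longleftrightarrow> x \<in> arrows G \<and> range_of G x = x"
  using range_unit[of x] unit_arrow[of x] range_of_unit[of x] by metis

lemma left_cancel:
  assumes "(a, b) \<in> composable G" "(a, b') \<in> composable G" "a \<star> b = a \<star> b'"
  shows "b = b'"
  using cancel_left[OF assms(1)] cancel_left[OF assms(2)] assms(3) by metis

lemma right_cancel:
  assumes "(a, b) \<in> composable G" "(a', b) \<in> composable G" "a \<star> b = a' \<star> b"
  shows "a = a'"
  using cancel_right[OF assms(1)] cancel_right[OF assms(2)] assms(3) by metis

lemma idempotent_unit:
  assumes "(a, a) \<in> composable G" "a \<star> a = a"
  shows "a \<in> unit_space G"
proof -
  have a: "a \<in> arrows G" using composable_arrows assms(1) by blast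
  have "a = range_of G a"
    using right_cancel[OF assms(1) range_mult_self(1)[OF a]] range_mult_self(2)[OF a] assms(2)
    by simp
  then show ?thesis using range_unit[OF a] by simp
qed

lemma inv_unique:
  assumes "(a, b) \<in> composable G" "a \<star> b \<in> unit_space G"
  shows "b = ginv G a"
proof (rule left_cancel[OF assms(1)])
  have a: "a \<in> arrows G" using composable_arrows assms(1) by blast
  show "(a, ginv G a) \<in> composable G" by (rule inv_composable[OF a])
  show "a \<star> b = a \<star> ginv G a"
    using range_mult[OF assms(1)] range_of_unit[OF assms(2)] range_of_def[of G a] by simp
qed

lemma continuous_range: "continuous_map (gtop G) (gtop G) (range_of G)"
proof -
  have "continuous_map (gtop G) (subtopology (prod_topology (gtop G) (gtop G)) (composable G))
      (\<lambda>a. (a, ginv G a))"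
    by (intro continuous_map_into_subtopology continuous_map_pairedI continuous_inv)
      (auto intro: inv_composable)
  from continuous_map_compose[OF this continuous_mult] show ?thesis
    by (simp add: o_def range_of_def[abs_def])
qed

lemma continuous_source: "continuous_map (gtop G) (gtop G) (source_of G)"
proof (rule continuous_map_eq)
  show "continuous_map (gtop G) (gtop G) (range_of G \<circ> ginv G)"
    by (rule continuous_map_compose[OF continuous_inv continuous_range])
qed (simp add: range_inv)

lemma closed_unit_space:
  assumes "Hausdorff_space (gtop G)"
  shows "closedin (gtop G) (unit_space G)"
proof -
  have "closedin (gtop G) {a \<in> topspace (gtop G). range_of G a = a}"
    by (rule closedin_continuous_maps_eq[OF assms continuous_range continuous_map_id[unfolded id_def]])
  moreover have "{a \<in> topspace (gtop G). range_of G a = a} = unit_space G"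
    using unit_space_iff by blast
  ultimately show ?thesis by simp
qed

text \<open>
  In a Hausdorff groupoid the composable pairs form a closed subset of the square, which makes
  products of compact sets compact.
\<close>

lemma compact_setwise_product:
  assumes H: "Hausdorff_space (gtop G)" and C: "compactin (gtop G) C" and D: "compactin (gtop G) D"
  shows "compactin (gtop G) {a \<star> b | a b. a \<in> C \<and> b \<in> D \<and> (a, b) \<in> composable G}"
proof -
  let ?P = "prod_topology (gtop G) (gtop G)"
  have "closedin ?P {p \<in> topspace ?P. (source_of G \<circ> fst) p = (range_of G \<circ> snd) p}"
    by (rule closedin_continuous_maps_eq[OF H])
      (intro continuous_map_compose[OF continuous_map_fst continuous_source]
        continuous_map_compose[OF continuous_map_snd continuous_range])+
  also have "{p \<in> topspace ?P. (source_of G \<circ> fst) p = (range_of G \<circ> snd) p} = composable G"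
    using composable_iff composable_subset by auto
  finally have "closedin ?P (composable G)" .
  then have "compactin ?P ((C \<times> D) \<inter> composable G)"
    using C D by (intro compact_Int_closedin) (auto simp: compactin_Times)
  then have "compactin (subtopology ?P (composable G)) ((C \<times> D) \<inter> composable G)"
    by (simp add: compactin_subtopology)
  from image_compactin[OF this continuous_mult]
  have "compactin (gtop G) ((\<lambda>(a, b). a \<star> b) ` ((C \<times> D) \<inter> composable G))" .
  moreover have "(\<lambda>(a, b). a \<star> b) ` ((C \<times> D) \<inter> composable G)
      = {a \<star> b | a b. a \<in> C \<and> b \<in> D \<and> (a, b) \<in> composable G}"
    by force
  ultimately show ?thesis by simp
qed

end

lemma hom_unit:
  assumes "topological_groupoid G" "topological_groupoid H" "continuous_groupoid_hom G H f"
    and x: "x \<in> unit_space G"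
  shows "f x \<in> unit_space H"
proof -
  interpret G: topological_groupoid G by fact
  interpret H: topological_groupoid H by fact
  have "(x, x) \<in> composable G" "x \<star>\<^bsub>G\<^esub> x = x"
    using G.range_mult_self[OF G.unit_arrow[OF x]] x by simp_all
  then have "(f x, f x) \<in> composable H" "f x \<star>\<^bsub>H\<^esub> f x = f x"
    using assms(3) unfolding continuous_groupoid_hom_def by fastforce+
  then show ?thesis by (rule H.idempotent_unit)
qed

lemma hom_inv:
  assumes "topological_groupoid G" "topological_groupoid H" "continuous_groupoid_hom G H f"
    and a: "a \<in> arrows G"
  shows "f (ginv G a) = ginv H (f a)"
proof -
  interpret G: topological_groupoid G by fact
  interpret H: topological_groupoid H by fact
  have "(f a, f (ginv G a)) \<in> composable H \<and> f (range_of G a) = f a \<star>\<^bsub>H\<^esub> f (ginv G a)"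
    using G.inv_composable[OF a] assms(3)
    unfolding continuous_groupoid_hom_def range_of_def by fastforce
  moreover have "f (range_of G a) \<in> unit_space H"
    by (rule hom_unit[OF assms(1-3) G.range_unit[OF a]])
  ultimately show ?thesis using H.inv_unique by simp
qed

lemma hom_range_source:
  assumes "topological_groupoid G" "topological_groupoid H" "continuous_groupoid_hom G H f"
    and a: "a \<in> arrows G"
  shows "f (range_of G a) = range_of H (f a)" "f (source_of G a) = source_of H (f a)"
proof -
  interpret G: topological_groupoid G by fact
  show "f (range_of G a) = range_of H (f a)"
    using G.inv_composable[OF a] assms(3) hom_inv[OF assms]
    unfolding continuous_groupoid_hom_def range_of_def by fastforce
  show "f (source_of G a) = source_of H (f a)"
    using G.inv_composable'[OF a] assms(3) hom_inv[OF assms]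
    unfolding continuous_groupoid_hom_def source_of_def by fastforce
qed


section \<open>Bisections and isotropy in etale groupoids\<close>

context etale_groupoid
begin

text \<open>
  On a neighbourhood \<open>U\<close> of a unit where the source map is injective, an arrow \<open>y\<close> with
  source in \<open>U\<close> has the same source as \<open>source_of G y\<close>, so it is a unit.
\<close>

lemma open_unit_space: "openin (gtop G) (unit_space G)"
proof (subst openin_subopen, intro ballI)
  fix x assume x: "x \<in> unit_space G"
  obtain U where U: "openin (gtop G) U" "x \<in> U"
      "homeomorphic_map (subtopology (gtop G) U) (subtopology (unit_topology G) (source_of G ` U))
        (source_of G)"
    using source_local_homeomorphism unit_arrow[OF x] unfolding local_homeomorphism_def by blast
  have sub: "U \<subseteq> arrows G" using U(1) openin_subset by blast
  have inj: "inj_on (source_of G) U"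
    using homeomorphic_imp_injective_map[OF U(3)] sub by (simp add: Int_absorb1)
  let ?V = "{y \<in> U. source_of G y \<in> U}"
  have "openin (gtop G) ?V"
    by (rule openin_continuous_map_preimage_gen[OF continuous_source U(1) U(1)])
  moreover have "x \<in> ?V" using x U(2) by simp
  moreover have "?V \<subseteq> unit_space G"
  proof
    fix y assume y: "y \<in> ?V"
    then have "source_of G y = y"
      using inj sub by (auto dest!: inj_onD[of _ _ "source_of G y" y])
    then show "y \<in> unit_space G" using source_unit[of y] y sub by auto
  qed
  ultimately show "\<exists>T. openin (gtop G) T \<and> x \<in> T \<and> T \<subseteq> unit_space G" by blast
qed

lemma openin_unit_topology:
  "openin (unit_topology G) U \<longleftrightarrow> openin (gtop G) U \<and> U \<subseteq> unit_space G"
  using openin_open_subtopology[OF open_unit_space] by blast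

lemma bisection_open: "open_bisection G B \<Longrightarrow> openin (gtop G) B"
  unfolding open_bisection_def by blast

lemma bisection_subset: "open_bisection G B \<Longrightarrow> B \<subseteq> arrows G"
  using bisection_open openin_subset by blast

lemma bisection_range_inj:
  assumes "open_bisection G B"
  shows "inj_on (range_of G) B"
proof -
  have "homeomorphic_map (subtopology (gtop G) B)
      (subtopology (unit_topology G) (range_of G ` B)) (range_of G)"
    using assms unfolding open_bisection_def by blast
  from homeomorphic_imp_injective_map[OF this] show ?thesis
    using bisection_subset[OF assms] by (simp add: Int_absorb1)
qed

lemma bisection_range_open:
  assumes B: "open_bisection G B" and V: "openin (gtop G) V" "V \<subseteq> B"
  shows "openin (gtop G) (range_of G ` V)"
proof -
  have h: "homeomorphic_map (subtopology (gtop G) B)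
      (subtopology (unit_topology G) (range_of G ` B)) (range_of G)"
    and o: "openin (unit_topology G) (range_of G ` B)"
    using B unfolding open_bisection_def by blast+
  have "openin (subtopology (gtop G) B) V"
    using V bisection_open[OF B] by (simp add: openin_open_subtopology)
  then have "openin (subtopology (unit_topology G) (range_of G ` B)) (range_of G ` V)"
    using homeomorphic_imp_open_map[OF h] unfolding open_map_def by blast
  then show ?thesis
    using o openin_open_subtopology[OF o] openin_unit_topology by blast
qed

text \<open>
  A non-isotropic arrow of \<open>B\<close> inside \<open>U\<close> has distinct end points; separating them by disjoint
  open sets and following \<open>B\<close> from one to the other gives the smaller open set.
\<close>

lemma shrink_off_bisection:
  assumes H: "Hausdorff_space (gtop G)" and B: "open_bisection G B"
    and U: "openin (gtop G) U" "U \<subseteq> unit_space G" "U \<noteq> {}"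
    and noniso: "\<And>V. openin (gtop G) V \<Longrightarrow> V \<subseteq> B \<Longrightarrow> V \<subseteq> isotropy G \<Longrightarrow> V = {}"
  obtains W where "openin (gtop G) W" "W \<subseteq> U" "W \<noteq> {}"
    "\<And>b. b \<in> B \<Longrightarrow> \<not> (range_of G b \<in> W \<and> source_of G b \<in> W)"
proof -
  note Bo = bisection_open[OF B] and Bs = bisection_subset[OF B]
  let ?V = "{b \<in> {b \<in> B. range_of G b \<in> U}. source_of G b \<in> U}"
  have Vo: "openin (gtop G) ?V"
    by (intro openin_continuous_map_preimage_gen[OF continuous_source _ U(1)]
        openin_continuous_map_preimage_gen[OF continuous_range Bo U(1)])
  show ?thesis
  proof (cases "?V = {}")
    case True
    then show ?thesis using that[of U] U by auto
  next
    case False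
    then obtain a where a: "a \<in> ?V" "a \<notin> isotropy G" using noniso[OF Vo] by blast
    then have "range_of G a \<in> arrows G" "source_of G a \<in> arrows G"
        "range_of G a \<noteq> source_of G a"
      using Bs by (auto simp: isotropy_def)
    then obtain W1 W2 where W: "openin (gtop G) W1" "openin (gtop G) W2"
        "range_of G a \<in> W1" "source_of G a \<in> W2" "disjnt W1 W2"
      using H unfolding Hausdorff_space_def by metis
    let ?V' = "{b \<in> {b \<in> ?V. range_of G b \<in> W1}. source_of G b \<in> W2}"
    have V'o: "openin (gtop G) ?V'"
      by (intro openin_continuous_map_preimage_gen[OF continuous_source _ W(2)]
          openin_continuous_map_preimage_gen[OF continuous_range Vo W(1)])
    show ?thesis
    proof (rule that[of "range_of G ` ?V'"])
      show "openin (gtop G) (range_of G ` ?V')"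
        by (rule bisection_range_open[OF B V'o]) auto
      show "range_of G ` ?V' \<subseteq> U" by auto
      show "range_of G ` ?V' \<noteq> {}" using a(1) W by blast
    next
      fix b assume b: "b \<in> B"
      show "\<not> (range_of G b \<in> range_of G ` ?V' \<and> source_of G b \<in> range_of G ` ?V')"
      proof
        assume as: "range_of G b \<in> range_of G ` ?V' \<and> source_of G b \<in> range_of G ` ?V'"
        then obtain c where "c \<in> ?V'" "range_of G b = range_of G c" by blast
        then have "b \<in> ?V'"
          using bisection_range_inj[OF B] b by (auto dest: inj_onD)
        then have "source_of G b \<in> W2" by blast
        moreover have "source_of G b \<in> W1" using as by auto
        ultimately show False using W(5) by (auto simp: disjnt_def)
      qed
    qed
  qed
qed

end

context ample_groupoid
begin

lemma compact_bisection_cover: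
  assumes C: "compactin (gtop G) C" and W: "openin (gtop G) W" "C \<subseteq> W"
  obtains F where "finite F" "\<And>B. B \<in> F \<Longrightarrow> open_bisection G B \<and> B \<subseteq> W" "C \<subseteq> \<Union>F"
proof -
  let ?U = "{B. open_bisection G B \<and> B \<subseteq> W}"
  have "C \<subseteq> \<Union>?U" using compact_open_bisection_basis[OF W(1)] W(2) by blast
  moreover have "\<And>B. B \<in> ?U \<Longrightarrow> openin (gtop G) B" using bisection_open by blast
  ultimately obtain F where "finite F" "F \<subseteq> ?U" "C \<subseteq> \<Union>F"
    using compactinD[OF C, of ?U] by blast
  then show ?thesis using that[of F] by blast
qed

text \<open>
  This makes the convolution sums finite; an infinite one would have the default value zero.
\<close>

lemma finite_compact_range_fibre:
  assumes C: "compactin (gtop G) C"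
  shows "finite {a \<in> C. range_of G a = x}"
proof -
  obtain F where F: "finite F" "\<And>B. B \<in> F \<Longrightarrow> open_bisection G B \<and> B \<subseteq> arrows G" "C \<subseteq> \<Union>F"
    using compact_bisection_cover[OF C openin_topspace] compactin_subset_topspace[OF C] by metis
  have "finite {a \<in> B. range_of G a = x}" if "B \<in> F" for B
  proof (rule inj_on_finite[where f = "range_of G" and B = "{x}"])
    show "inj_on (range_of G) {a \<in> B. range_of G a = x}"
      using bisection_range_inj F(2)[OF that] by (auto intro: inj_on_subset)
  qed auto
  then have "finite (\<Union>B\<in>F. {a \<in> B. range_of G a = x})" using F(1) by blast
  then show ?thesis by (rule rev_finite_subset) (use F(3) in auto)
qed

text \<open>
  Cover \<open>D\<close> by finitely many bisections inside \<open>E\<close> and shrink off them one at a time. With \<open>E\<close> the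
  set of non-units in an effective open subgroupoid, the hypothesis on \<open>E\<close> is effectiveness.
\<close>

lemma shrink_off_compact:
  assumes H: "Hausdorff_space (gtop G)"
    and D: "compactin (gtop G) D" and E: "openin (gtop G) E" "D \<subseteq> E"
    and noniso: "\<And>V. openin (gtop G) V \<Longrightarrow> V \<subseteq> E \<Longrightarrow> V \<subseteq> isotropy G \<Longrightarrow> V = {}"
    and U: "openin (gtop G) U" "U \<subseteq> unit_space G" "U \<noteq> {}"
  obtains W where "openin (gtop G) W" "W \<subseteq> U" "W \<noteq> {}"
    "\<And>b. b \<in> D \<Longrightarrow> \<not> (range_of G b \<in> W \<and> source_of G b \<in> W)"
proof -
  obtain F where F: "finite F" "\<And>B. B \<in> F \<Longrightarrow> open_bisection G B \<and> B \<subseteq> E" "D \<subseteq> \<Union>F"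
    using compact_bisection_cover[OF D E] by metis
  have "\<exists>W. openin (gtop G) W \<and> W \<subseteq> U \<and> W \<noteq> {} \<and>
      (\<forall>b \<in> \<Union>F. \<not> (range_of G b \<in> W \<and> source_of G b \<in> W))"
    using F(1,2)
  proof (induction F rule: finite_induct)
    case empty
    then show ?case using U by auto
  next
    case (insert B F)
    then obtain W where W: "openin (gtop G) W" "W \<subseteq> U" "W \<noteq> {}"
        "\<forall>b \<in> \<Union>F. \<not> (range_of G b \<in> W \<and> source_of G b \<in> W)"
      by auto
    have B: "open_bisection G B" "B \<subseteq> E" using insert.prems by auto
    have Wu: "W \<subseteq> unit_space G" using W(2) U(2) by blast
    obtain W' where W': "openin (gtop G) W'" "W' \<subseteq> W" "W' \<noteq> {}"
        "\<And>b. b \<in> B \<Longrightarrow> \<not> (range_of G b \<in> W' \<and> source_of G b \<in> W')"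
      using shrink_off_bisection[OF H B(1) W(1) Wu W(3)] noniso B(2) by (metis order_trans)
    have "\<not> (range_of G b \<in> W' \<and> source_of G b \<in> W')" if "b \<in> \<Union>(insert B F)" for b
    proof (cases "b \<in> B")
      case False
      then have "b \<in> \<Union>F" using that by simp
      then show ?thesis using W(4) W'(2) by blast
    qed (rule W'(4))
    then show ?case using W(2) W'(1-3) by blast
  qed
  then show ?thesis using that F(3) by blast
qed

end

section \<open>The scalar action on a discrete twist\<close>

locale ample_twist = G: ample_groupoid G + R: cring R + discrete_twist G R \<Sigma> i q
  for G :: "('g, 'm) groupoid_scheme" and R :: "('r, 'n) ring_scheme"
    and \<Sigma> :: "('s, 'k) groupoid_scheme" and i :: "'g \<times> 'r \<Rightarrow> 's" and q :: "'s \<Rightarrow> 'g" +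
  assumes Hausdorff_base: "Hausdorff_space (gtop G)"
begin

abbreviation scale :: "'r \<Rightarrow> 's \<Rightarrow> 's" (infixr \<open>\<cdot>\<close> 75) where
  "t \<cdot> \<sigma> \<equiv> twist_action \<Sigma> i q t \<sigma>"

lemma continuous_q: "continuous_map (gtop \<Sigma>) (gtop G) q"
  using q_hom unfolding continuous_groupoid_hom_def by blast

lemma q_closed [simp]: "\<sigma> \<in> arrows \<Sigma> \<Longrightarrow> q \<sigma> \<in> arrows G"
  using continuous_q by (auto simp: continuous_map_def Pi_iff)

lemma q_mult: "(\<sigma>, \<tau>) \<in> composable \<Sigma> \<Longrightarrow> q (\<sigma> \<star>\<^bsub>\<Sigma>\<^esub> \<tau>) = q \<sigma> \<star>\<^bsub>G\<^esub> q \<tau>"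
  using q_hom unfolding continuous_groupoid_hom_def by auto

lemma q_composable: "(\<sigma>, \<tau>) \<in> composable \<Sigma> \<Longrightarrow> (q \<sigma>, q \<tau>) \<in> composable G"
  using q_hom unfolding continuous_groupoid_hom_def by auto

lemmas q_unit = hom_unit[OF \<Sigma>.topological_groupoid_axioms G.topological_groupoid_axioms q_hom]
lemmas q_inv = hom_inv[OF \<Sigma>.topological_groupoid_axioms G.topological_groupoid_axioms q_hom]
lemmas q_range =
  hom_range_source(1)[OF \<Sigma>.topological_groupoid_axioms G.topological_groupoid_axioms q_hom]
lemmas q_source =
  hom_range_source(2)[OF \<Sigma>.topological_groupoid_axioms G.topological_groupoid_axioms q_hom]

lemma q_inj_units: "inj_on q (unit_space \<Sigma>)"
  using homeomorphic_imp_injective_map[OF q_units] \<Sigma>.unit_space_subset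
  by (simp add: Int_absorb1)

lemma range_eq_iff_q:
  assumes "\<sigma> \<in> arrows \<Sigma>" "\<tau> \<in> arrows \<Sigma>"
  shows "range_of \<Sigma> \<sigma> = range_of \<Sigma> \<tau> \<longleftrightarrow> range_of G (q \<sigma>) = range_of G (q \<tau>)"
  using inj_on_eq_iff[OF q_inj_units] \<Sigma>.range_unit assms q_range by metis

lemma composable_iff_q:
  assumes "\<sigma> \<in> arrows \<Sigma>" "\<tau> \<in> arrows \<Sigma>"
  shows "(\<sigma>, \<tau>) \<in> composable \<Sigma> \<longleftrightarrow> source_of G (q \<sigma>) = range_of G (q \<tau>)"
  unfolding \<Sigma>.composable_iff[OF assms]
  using inj_on_eq_iff[OF q_inj_units] \<Sigma>.range_unit \<Sigma>.source_unit assms q_range q_source by metis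

lemma fibre_closed:
  assumes "x \<in> unit_space G" "t \<in> Units R"
  shows "i (x, t) \<in> arrows \<Sigma>" "q (i (x, t)) = x"
  using fibre[OF assms(1)] assms(2) by blast+

lemma fibre_mult:
  assumes "x \<in> unit_space G" "t \<in> Units R" "u \<in> Units R"
  shows "(i (x, t), i (x, u)) \<in> composable \<Sigma>"
    "i (x, t) \<star>\<^bsub>\<Sigma>\<^esub> i (x, u) = i (x, t \<otimes>\<^bsub>R\<^esub> u)"
proof -
  have "((x, t), (x, u)) \<in> composable (trivial_bundle G R)"
    using assms by (auto simp: trivial_bundle_def)
  then have "(i (x, t), i (x, u)) \<in> composable \<Sigma> \<and>
      i ((x, t) \<star>\<^bsub>trivial_bundle G R\<^esub> (x, u)) = i (x, t) \<star>\<^bsub>\<Sigma>\<^esub> i (x, u)"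
    using i_hom unfolding continuous_groupoid_hom_def by blast
  then show "(i (x, t), i (x, u)) \<in> composable \<Sigma>"
    "i (x, t) \<star>\<^bsub>\<Sigma>\<^esub> i (x, u) = i (x, t \<otimes>\<^bsub>R\<^esub> u)"
    by (simp_all add: trivial_bundle_def)
qed

lemma fibre_one_unit: "x \<in> unit_space G \<Longrightarrow> i (x, \<one>\<^bsub>R\<^esub>) \<in> unit_space \<Sigma>"
  using unit_space_eq by blast

lemma q_range_unit: "\<sigma> \<in> arrows \<Sigma> \<Longrightarrow> q (range_of \<Sigma> \<sigma>) \<in> unit_space G"
  by (simp add: \<Sigma>.range_unit q_unit)

lemma scale_composable:
  assumes "\<sigma> \<in> arrows \<Sigma>" "t \<in> Units R"
  shows "(i (q (range_of \<Sigma> \<sigma>), t), \<sigma>) \<in> composable \<Sigma>"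
  using fibre_closed[OF q_range_unit[OF assms(1)] assms(2)] q_range_unit[OF assms(1)] assms
  by (simp add: composable_iff_q q_range)

lemma scale_closed [simp]: "\<lbrakk>\<sigma> \<in> arrows \<Sigma>; t \<in> Units R\<rbrakk> \<Longrightarrow> t \<cdot> \<sigma> \<in> arrows \<Sigma>"
  unfolding twist_action_def by (rule \<Sigma>.mult_closed[OF scale_composable])

lemma q_scale [simp]:
  assumes "\<sigma> \<in> arrows \<Sigma>" "t \<in> Units R"
  shows "q (t \<cdot> \<sigma>) = q \<sigma>"
  using q_mult[OF scale_composable[OF assms]] fibre_closed[OF q_range_unit[OF assms(1)] assms(2)]
    G.range_mult_self(2)[OF q_closed[OF assms(1)]] assms
  by (simp add: twist_action_def q_range)

lemma range_scale:
  assumes "\<sigma> \<in> arrows \<Sigma>" "t \<in> Units R"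
  shows "range_of \<Sigma> (t \<cdot> \<sigma>) = range_of \<Sigma> \<sigma>"
  using assms by (simp add: range_eq_iff_q)

lemma scale_mult_left:
  assumes "(\<sigma>, \<tau>) \<in> composable \<Sigma>" "t \<in> Units R"
  shows "(t \<cdot> \<sigma>) \<star>\<^bsub>\<Sigma>\<^esub> \<tau> = t \<cdot> (\<sigma> \<star>\<^bsub>\<Sigma>\<^esub> \<tau>)"
  using \<Sigma>.assoc[OF scale_composable[OF \<Sigma>.composable_arrows(1)[OF assms(1)] assms(2)] assms(1)]
    \<Sigma>.range_mult[OF assms(1)]
  by (simp add: twist_action_def)

lemma scale_one:
  assumes "\<sigma> \<in> arrows \<Sigma>"
  shows "\<one>\<^bsub>R\<^esub> \<cdot> \<sigma> = \<sigma>"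
proof -
  have "i (q (range_of \<Sigma> \<sigma>), \<one>\<^bsub>R\<^esub>) = range_of \<Sigma> \<sigma>"
    using inj_onD[OF q_inj_units _ fibre_one_unit[OF q_range_unit[OF assms]] \<Sigma>.range_unit[OF assms]]
      fibre_closed(2)[OF q_range_unit[OF assms] R.Units_one_closed] by simp
  then show ?thesis
    unfolding twist_action_def using \<Sigma>.range_mult_self(2)[OF assms] by simp
qed

lemma scale_scale:
  assumes "\<sigma> \<in> arrows \<Sigma>" "t \<in> Units R" "u \<in> Units R"
  shows "t \<cdot> u \<cdot> \<sigma> = (t \<otimes>\<^bsub>R\<^esub> u) \<cdot> \<sigma>"
proof -
  let ?x = "q (range_of \<Sigma> \<sigma>)"
  note x = q_range_unit[OF assms(1)]
  have "t \<cdot> u \<cdot> \<sigma> = i (?x, t) \<star>\<^bsub>\<Sigma>\<^esub> (i (?x, u) \<star>\<^bsub>\<Sigma>\<^esub> \<sigma>)"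
    using range_scale[OF assms(1,3)] by (simp add: twist_action_def)
  also have "\<dots> = (i (?x, t) \<star>\<^bsub>\<Sigma>\<^esub> i (?x, u)) \<star>\<^bsub>\<Sigma>\<^esub> \<sigma>"
    using \<Sigma>.assoc[OF fibre_mult(1)[OF x assms(2,3)] scale_composable[OF assms(1,3)]] by simp
  finally show ?thesis
    using fibre_mult(2)[OF x assms(2,3)] by (simp add: twist_action_def)
qed

text \<open>This is where centrality of the fibres over the units enters.\<close>

lemma scale_mult_right:
  assumes c: "(\<sigma>, \<tau>) \<in> composable \<Sigma>" and t: "t \<in> Units R"
  shows "\<sigma> \<star>\<^bsub>\<Sigma>\<^esub> (t \<cdot> \<tau>) = t \<cdot> (\<sigma> \<star>\<^bsub>\<Sigma>\<^esub> \<tau>)"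
proof -
  note \<sigma> = \<Sigma>.composable_arrows(1)[OF c] and \<tau> = \<Sigma>.composable_arrows(2)[OF c]
  have x: "q (source_of \<Sigma> \<sigma>) = q (range_of \<Sigma> \<tau>)"
    using \<Sigma>.composable_imp_source_eq_range[OF c] by simp
  let ?e = "i (q (range_of \<Sigma> \<tau>), t)"
  have "(\<sigma>, ?e) \<in> composable \<Sigma>"
    using fibre_closed[OF q_range_unit[OF \<tau>] t] q_range_unit[OF \<tau>] x \<sigma>
    by (simp add: composable_iff_q q_source)
  from \<Sigma>.assoc[OF this scale_composable[OF \<tau> t]]
  have "\<sigma> \<star>\<^bsub>\<Sigma>\<^esub> (t \<cdot> \<tau>) = (\<sigma> \<star>\<^bsub>\<Sigma>\<^esub> ?e) \<star>\<^bsub>\<Sigma>\<^esub> \<tau>"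
    by (simp add: twist_action_def)
  also have "\<sigma> \<star>\<^bsub>\<Sigma>\<^esub> ?e = t \<cdot> \<sigma>"
    using central[OF \<sigma> t] x by (simp add: twist_action_def)
  also have "(t \<cdot> \<sigma>) \<star>\<^bsub>\<Sigma>\<^esub> \<tau> = t \<cdot> (\<sigma> \<star>\<^bsub>\<Sigma>\<^esub> \<tau>)"
    by (rule scale_mult_left[OF c t])
  finally show ?thesis .
qed

lemma inv_scale:
  assumes "\<sigma> \<in> arrows \<Sigma>" "t \<in> Units R"
  shows "ginv \<Sigma> (t \<cdot> \<sigma>) = inv\<^bsub>R\<^esub> t \<cdot> ginv \<Sigma> \<sigma>"
proof (rule sym, rule \<Sigma>.inv_unique)
  note u = R.Units_inv_Units[OF assms(2)]
  show c: "(t \<cdot> \<sigma>, inv\<^bsub>R\<^esub> t \<cdot> ginv \<Sigma> \<sigma>) \<in> composable \<Sigma>"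
    using assms u \<Sigma>.inv_closed[OF assms(1)]
    by (simp add: composable_iff_q q_inv G.range_inv)
  have c': "(\<sigma>, inv\<^bsub>R\<^esub> t \<cdot> ginv \<Sigma> \<sigma>) \<in> composable \<Sigma>"
    using assms u \<Sigma>.inv_closed[OF assms(1)]
    by (simp add: composable_iff_q q_inv G.range_inv)
  have "(t \<cdot> \<sigma>) \<star>\<^bsub>\<Sigma>\<^esub> (inv\<^bsub>R\<^esub> t \<cdot> ginv \<Sigma> \<sigma>) = t \<cdot> inv\<^bsub>R\<^esub> t \<cdot> range_of \<Sigma> \<sigma>"
    using scale_mult_left[OF c' assms(2)] scale_mult_right[OF \<Sigma>.inv_composable[OF assms(1)] u]
    by (simp add: range_of_def)
  also have "\<dots> = range_of \<Sigma> \<sigma>"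
    using assms u by (simp add: scale_scale scale_one)
  finally show "(t \<cdot> \<sigma>) \<star>\<^bsub>\<Sigma>\<^esub> (inv\<^bsub>R\<^esub> t \<cdot> ginv \<Sigma> \<sigma>) \<in> unit_space \<Sigma>"
    using \<Sigma>.range_unit[OF assms(1)] by simp
qed

lemma scale_inj:
  assumes "\<sigma> \<in> arrows \<Sigma>" "t \<in> Units R" "u \<in> Units R" "t \<cdot> \<sigma> = u \<cdot> \<sigma>"
  shows "t = u"
proof -
  note x = q_range_unit[OF assms(1)]
  have "i (q (range_of \<Sigma> \<sigma>), t) = i (q (range_of \<Sigma> \<sigma>), u)"
    using \<Sigma>.right_cancel[OF scale_composable[OF assms(1,2)] scale_composable[OF assms(1,3)]] assms(4)
    by (simp add: twist_action_def)
  from inj_onD[OF i_inj this] show ?thesis using x assms(2,3) by simp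
qed

text \<open>The quotient \<open>\<tau>\<sigma>\<^sup>-\<^sup>1\<close> lies over a unit, so exactness of the twist makes it a scalar.\<close>

lemma same_fibre_imp_scale:
  assumes \<sigma>: "\<sigma> \<in> arrows \<Sigma>" and \<tau>: "\<tau> \<in> arrows \<Sigma>" and eq: "q \<sigma> = q \<tau>"
  obtains t where "t \<in> Units R" "\<tau> = t \<cdot> \<sigma>"
proof -
  have c: "(\<tau>, ginv \<Sigma> \<sigma>) \<in> composable \<Sigma>"
    using \<sigma> \<tau> eq \<Sigma>.inv_closed[OF \<sigma>] by (simp add: composable_iff_q q_inv G.range_inv)
  have "q (\<tau> \<star>\<^bsub>\<Sigma>\<^esub> ginv \<Sigma> \<sigma>) = q (range_of \<Sigma> \<sigma>)"
    using q_mult[OF c] q_inv[OF \<sigma>] q_range[OF \<sigma>] eq by (simp add: range_of_def)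
  then have "\<tau> \<star>\<^bsub>\<Sigma>\<^esub> ginv \<Sigma> \<sigma> \<in> i ` ({q (range_of \<Sigma> \<sigma>)} \<times> Units R)"
    using fibre[OF q_range_unit[OF \<sigma>]] \<Sigma>.mult_closed[OF c] by simp
  then obtain t where t: "t \<in> Units R" "\<tau> \<star>\<^bsub>\<Sigma>\<^esub> ginv \<Sigma> \<sigma> = i (q (range_of \<Sigma> \<sigma>), t)"
    by auto
  have "t \<cdot> \<sigma> = (\<tau> \<star>\<^bsub>\<Sigma>\<^esub> ginv \<Sigma> \<sigma>) \<star>\<^bsub>\<Sigma>\<^esub> \<sigma>"
    using t(2) by (simp add: twist_action_def)
  also have "\<dots> = \<tau>"
    using \<Sigma>.cancel_right[OF c] \<Sigma>.inv_inv[OF \<sigma>] by simp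
  finally show ?thesis using that[OF t(1)] by simp
qed

lemma continuous_scale:
  assumes t: "t \<in> Units R"
  shows "continuous_map (gtop \<Sigma>) (gtop \<Sigma>) (\<lambda>\<sigma>. t \<cdot> \<sigma>)"
proof -
  have i: "continuous_map (prod_topology (unit_topology G) (discrete_topology (Units R))) (gtop \<Sigma>) i"
    using i_hom unfolding continuous_groupoid_hom_def trivial_bundle_def by simp
  have "continuous_map (gtop \<Sigma>) (gtop G) (\<lambda>\<sigma>. q (range_of \<Sigma> \<sigma>))"
    using continuous_map_compose[OF \<Sigma>.continuous_range continuous_q] by (simp add: o_def)
  then have "continuous_map (gtop \<Sigma>) (unit_topology G) (\<lambda>\<sigma>. q (range_of \<Sigma> \<sigma>))"
    by (rule continuous_map_into_subtopology) (auto intro: q_range_unit)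
  then have "continuous_map (gtop \<Sigma>) (prod_topology (unit_topology G) (discrete_topology (Units R)))
      (\<lambda>\<sigma>. (q (range_of \<Sigma> \<sigma>), t))"
    by (rule continuous_map_pairedI) (use t in simp)
  from continuous_map_compose[OF this i]
  have "continuous_map (gtop \<Sigma>) (gtop \<Sigma>) (\<lambda>\<sigma>. i (q (range_of \<Sigma> \<sigma>), t))" by (simp add: o_def)
  then have "continuous_map (gtop \<Sigma>)
      (subtopology (prod_topology (gtop \<Sigma>) (gtop \<Sigma>)) (composable \<Sigma>))
      (\<lambda>\<sigma>. (i (q (range_of \<Sigma> \<sigma>), t), \<sigma>))"
    using t by (intro continuous_map_into_subtopology continuous_map_pairedI)
      (auto intro: scale_composable)
  from continuous_map_compose[OF this \<Sigma>.continuous_mult] show ?thesis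
    by (simp add: o_def twist_action_def)
qed

lemma open_scale_image:
  assumes U: "openin (gtop \<Sigma>) U" and t: "t \<in> Units R"
  shows "openin (gtop \<Sigma>) ((\<lambda>\<sigma>. t \<cdot> \<sigma>) ` U)"
proof -
  note u = R.Units_inv_Units[OF t]
  have Us: "U \<subseteq> arrows \<Sigma>" using U openin_subset by blast
  have "(\<lambda>\<sigma>. t \<cdot> \<sigma>) ` U = {\<sigma> \<in> arrows \<Sigma>. inv\<^bsub>R\<^esub> t \<cdot> \<sigma> \<in> U}"
  proof (intro equalityI subsetI)
    fix \<sigma> assume "\<sigma> \<in> (\<lambda>\<sigma>. t \<cdot> \<sigma>) ` U"
    then obtain \<tau> where \<tau>: "\<tau> \<in> U" "\<sigma> = t \<cdot> \<tau>" by blast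
    then show "\<sigma> \<in> {\<sigma> \<in> arrows \<Sigma>. inv\<^bsub>R\<^esub> t \<cdot> \<sigma> \<in> U}"
      using Us t u by (auto simp: scale_scale scale_one subset_iff)
  next
    fix \<sigma> assume "\<sigma> \<in> {\<sigma> \<in> arrows \<Sigma>. inv\<^bsub>R\<^esub> t \<cdot> \<sigma> \<in> U}"
    moreover then have "\<sigma> = t \<cdot> inv\<^bsub>R\<^esub> t \<cdot> \<sigma>"
      using t u by (simp add: scale_scale scale_one)
    ultimately show "\<sigma> \<in> (\<lambda>\<sigma>. t \<cdot> \<sigma>) ` U" by blast
  qed
  then show ?thesis
    using openin_continuous_map_preimage[OF continuous_scale[OF u] U] by simp
qed


section \<open>Local sections of the quotient map\<close>

text \<open>
  Translating the section given by local triviality by a scalar makes it pass through \<open>\<sigma>\<close>. The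
  slices \<open>V \<times> {t}\<close> are open because the scalars are discrete, and the trivialisation carries them
  to the images of \<open>V\<close>.
\<close>

lemma local_section:
  assumes \<sigma>: "\<sigma> \<in> arrows \<Sigma>"
  obtains B p where "open_bisection G B" "q \<sigma> \<in> B" "p (q \<sigma>) = \<sigma>"
    "continuous_map (subtopology (gtop G) B) (gtop \<Sigma>) p" "\<And>\<beta>. \<beta> \<in> B \<Longrightarrow> q (p \<beta>) = \<beta>"
    "\<And>V. openin (gtop G) V \<Longrightarrow> V \<subseteq> B \<Longrightarrow> openin (gtop \<Sigma>) (p ` V)"
proof -
  obtain B P where B: "open_bisection G B" "q \<sigma> \<in> B"
    and P: "continuous_map (subtopology (gtop G) B) (gtop \<Sigma>) P" "\<forall>\<beta> \<in> B. q (P \<beta>) = \<beta>"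
    and h: "homeomorphic_map
          (prod_topology (subtopology (gtop G) B) (discrete_topology (Units R)))
          (subtopology (gtop \<Sigma>) {\<sigma> \<in> arrows \<Sigma>. q \<sigma> \<in> B})
          (\<lambda>(\<beta>, t). i (range_of G \<beta>, t) \<star>\<^bsub>\<Sigma>\<^esub> P \<beta>)"
    using local_triviality[OF q_closed[OF \<sigma>]] by blast
  note Bo = G.bisection_open[OF B(1)] and Bs = G.bisection_subset[OF B(1)]
  have Pa: "P \<beta> \<in> arrows \<Sigma>" if "\<beta> \<in> B" for \<beta>
    using P(1) that Bs by (auto simp: continuous_map_def Pi_iff)
  have act: "i (range_of G \<beta>, t) \<star>\<^bsub>\<Sigma>\<^esub> P \<beta> = t \<cdot> P \<beta>" if "\<beta> \<in> B" for \<beta> t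
    using P(2) that Pa[OF that] by (simp add: twist_action_def q_range)
  obtain t where t: "t \<in> Units R" "\<sigma> = t \<cdot> P (q \<sigma>)"
    using same_fibre_imp_scale[OF Pa[OF B(2)] \<sigma>] P(2) B(2) by auto
  show ?thesis
  proof (rule that[of B "\<lambda>\<beta>. t \<cdot> P \<beta>"])
    show "continuous_map (subtopology (gtop G) B) (gtop \<Sigma>) (\<lambda>\<beta>. t \<cdot> P \<beta>)"
      using continuous_map_compose[OF P(1) continuous_scale[OF t(1)]] by (simp add: o_def)
    show "q (t \<cdot> P \<beta>) = \<beta>" if "\<beta> \<in> B" for \<beta> using that P(2) Pa t(1) by simp
  next
    fix V assume V: "openin (gtop G) V" "V \<subseteq> B"
    have "openin (prod_topology (subtopology (gtop G) B) (discrete_topology (Units R))) (V \<times> {t})"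
      using V Bo t(1) by (auto simp: openin_prod_Times_iff openin_open_subtopology)
    then have "openin (subtopology (gtop \<Sigma>) {\<sigma> \<in> arrows \<Sigma>. q \<sigma> \<in> B})
        ((\<lambda>(\<beta>, t). i (range_of G \<beta>, t) \<star>\<^bsub>\<Sigma>\<^esub> P \<beta>) ` (V \<times> {t}))"
      using homeomorphic_imp_open_map[OF h] unfolding open_map_def by blast
    then have "openin (gtop \<Sigma>) ((\<lambda>(\<beta>, t). i (range_of G \<beta>, t) \<star>\<^bsub>\<Sigma>\<^esub> P \<beta>) ` (V \<times> {t}))"
      using openin_open_subtopology[OF openin_continuous_map_preimage[OF continuous_q Bo]] by blast
    also have "(\<lambda>(\<beta>, t). i (range_of G \<beta>, t) \<star>\<^bsub>\<Sigma>\<^esub> P \<beta>) ` (V \<times> {t})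
        = (\<lambda>\<beta>. i (range_of G \<beta>, t) \<star>\<^bsub>\<Sigma>\<^esub> P \<beta>) ` V"
    proof -
      have "V \<times> {t} = (\<lambda>\<beta>. (\<beta>, t)) ` V" by auto
      then show ?thesis by (simp add: image_image)
    qed
    also have "\<dots> = (\<lambda>\<beta>. t \<cdot> P \<beta>) ` V"
      by (intro image_cong refl act) (use V(2) in blast)
    finally show "openin (gtop \<Sigma>) ((\<lambda>\<beta>. t \<cdot> P \<beta>) ` V)" by simp
  qed (use B t in auto)
qed

text \<open>Local sections are right inverses of \<open>q\<close>, so they carry neighbourhoods back.\<close>

lemma q_open:
  assumes U: "openin (gtop \<Sigma>) U"
  shows "openin (gtop G) (q ` U)"
proof (subst openin_subopen, intro ballI)
  fix \<alpha> assume "\<alpha> \<in> q ` U"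
  then obtain \<sigma> where \<sigma>: "\<sigma> \<in> U" "\<alpha> = q \<sigma>" by blast
  then have "\<sigma> \<in> arrows \<Sigma>" using U openin_subset by blast
  from local_section[OF this] obtain B p where B: "open_bisection G B" "q \<sigma> \<in> B" "p (q \<sigma>) = \<sigma>"
    "continuous_map (subtopology (gtop G) B) (gtop \<Sigma>) p" "\<And>\<beta>. \<beta> \<in> B \<Longrightarrow> q (p \<beta>) = \<beta>"
    by metis
  let ?V = "{\<beta> \<in> topspace (subtopology (gtop G) B). p \<beta> \<in> U}"
  have "openin (subtopology (gtop G) B) ?V"
    by (rule openin_continuous_map_preimage[OF B(4) U])
  then have "openin (gtop G) ?V"
    using openin_open_subtopology[OF G.bisection_open[OF B(1)]] by blast
  moreover have "\<alpha> \<in> ?V" using \<sigma> B(2,3) G.bisection_subset[OF B(1)] by auto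
  moreover have "?V \<subseteq> q ` U" using B(5) by force
  ultimately show "\<exists>T. openin (gtop G) T \<and> \<alpha> \<in> T \<and> T \<subseteq> q ` U" by blast
qed

text \<open>
  Ampleness of \<open>G\<close> lifts to \<open>\<Sigma>\<close>: \<open>X\<close> is the image of a small compact open bisection of
  \<open>G\<close> under a local section.
\<close>

lemma compact_open_section_basis:
  assumes U: "openin (gtop \<Sigma>) U" and \<sigma>: "\<sigma> \<in> U"
  obtains X where "openin (gtop \<Sigma>) X" "compactin (gtop \<Sigma>) X" "inj_on q X"
    "open_bisection G (q ` X)" "\<sigma> \<in> X" "X \<subseteq> U"
proof -
  have "\<sigma> \<in> arrows \<Sigma>" using U \<sigma> openin_subset by blast
  from local_section[OF this] obtain B p where B: "open_bisection G B" "q \<sigma> \<in> B" "p (q \<sigma>) = \<sigma>"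
    "continuous_map (subtopology (gtop G) B) (gtop \<Sigma>) p" "\<And>\<beta>. \<beta> \<in> B \<Longrightarrow> q (p \<beta>) = \<beta>"
    "\<And>V. openin (gtop G) V \<Longrightarrow> V \<subseteq> B \<Longrightarrow> openin (gtop \<Sigma>) (p ` V)"
    by metis
  let ?V = "{\<beta> \<in> topspace (subtopology (gtop G) B). p \<beta> \<in> U}"
  have "openin (subtopology (gtop G) B) ?V"
    by (rule openin_continuous_map_preimage[OF B(4) U])
  then have "openin (gtop G) ?V"
    using openin_open_subtopology[OF G.bisection_open[OF B(1)]] by blast
  moreover have "q \<sigma> \<in> ?V" using \<sigma> B(2,3) G.bisection_subset[OF B(1)] by auto
  ultimately obtain C where C: "open_bisection G C" "compactin (gtop G) C" "q \<sigma> \<in> C" "C \<subseteq> ?V"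
    using G.compact_open_bisection_basis by blast
  have CB: "C \<subseteq> B" using C(4) by auto
  have qp: "q ` p ` C = C" using B(5) CB by (force simp: image_image)
  show ?thesis
  proof (rule that[of "p ` C"])
    show "openin (gtop \<Sigma>) (p ` C)" by (rule B(6)[OF G.bisection_open[OF C(1)] CB])
    show "compactin (gtop \<Sigma>) (p ` C)"
      by (rule image_compactin[OF _ B(4)]) (simp add: compactin_subtopology C(2) CB)
    show "inj_on q (p ` C)"
      by (rule inj_on_inverseI[where g = p]) (use B(5) CB in auto)
    show "open_bisection G (q ` p ` C)" using qp C(1) by simp
    show "\<sigma> \<in> p ` C" using C(3) B(3) by force
    show "p ` C \<subseteq> U" using C(4) by blast
  qed
qed

section \<open>Elements of the twisted Steinberg algebra\<close>

abbreviation steinberg :: "('s \<Rightarrow> 'r) set" where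
  "steinberg \<equiv> steinberg_functions G R \<Sigma> i q"

abbreviation tilde :: "'s set \<Rightarrow> 's \<Rightarrow> 'r" where
  "tilde X \<equiv> tilde_indicator R \<Sigma> i q X"

abbreviation conv :: "('s \<Rightarrow> 'r) \<Rightarrow> ('s \<Rightarrow> 'r) \<Rightarrow> 's \<Rightarrow> 'r" where
  "conv \<equiv> convolution G R \<Sigma> q"

lemma steinbergD:
  assumes "f \<in> steinberg"
  shows "\<And>\<sigma>. \<sigma> \<in> arrows \<Sigma> \<Longrightarrow> f \<sigma> \<in> carrier R" "f \<in> extensional (arrows \<Sigma>)"
    "locally_constant (gtop \<Sigma>) f"
    "\<And>t \<sigma>. t \<in> Units R \<Longrightarrow> \<sigma> \<in> arrows \<Sigma> \<Longrightarrow> f (t \<cdot> \<sigma>) = inv\<^bsub>R\<^esub> t \<otimes>\<^bsub>R\<^esub> f \<sigma>"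
    "compactin (gtop G) (suppG R \<Sigma> q f)"
  using assms unfolding steinberg_functions_def by (auto simp: PiE_def)

lemma q_in_suppG_iff:
  assumes cl: "\<And>\<sigma>. \<sigma> \<in> arrows \<Sigma> \<Longrightarrow> f \<sigma> \<in> carrier R"
    and contra: "\<And>t \<sigma>. t \<in> Units R \<Longrightarrow> \<sigma> \<in> arrows \<Sigma> \<Longrightarrow> f (t \<cdot> \<sigma>) = inv\<^bsub>R\<^esub> t \<otimes>\<^bsub>R\<^esub> f \<sigma>"
    and \<sigma>: "\<sigma> \<in> arrows \<Sigma>"
  shows "q \<sigma> \<in> suppG R \<Sigma> q f \<longleftrightarrow> f \<sigma> \<noteq> \<zero>\<^bsub>R\<^esub>"
proof
  assume "q \<sigma> \<in> suppG R \<Sigma> q f"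
  then obtain \<tau> where \<tau>: "\<tau> \<in> arrows \<Sigma>" "f \<tau> \<noteq> \<zero>\<^bsub>R\<^esub>" "q \<sigma> = q \<tau>"
    unfolding suppG_def by auto
  then obtain t where t: "t \<in> Units R" "\<tau> = t \<cdot> \<sigma>" using same_fibre_imp_scale[OF \<sigma>] by metis
  show "f \<sigma> \<noteq> \<zero>\<^bsub>R\<^esub>"
  proof
    assume "f \<sigma> = \<zero>\<^bsub>R\<^esub>"
    then show False using \<tau>(2) t contra[OF t(1) \<sigma>] by simp
  qed
qed (use \<sigma> in \<open>auto simp: suppG_def\<close>)

lemma open_level_set:
  assumes lc: "locally_constant (gtop \<Sigma>) f"
  shows "openin (gtop \<Sigma>) {\<sigma> \<in> arrows \<Sigma>. f \<sigma> = a}"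
proof (subst openin_subopen, intro ballI)
  fix \<sigma> assume \<sigma>: "\<sigma> \<in> {\<sigma> \<in> arrows \<Sigma>. f \<sigma> = a}"
  then obtain U where U: "openin (gtop \<Sigma>) U" "\<sigma> \<in> U" "\<forall>\<tau> \<in> U. f \<tau> = f \<sigma>"
    using lc unfolding locally_constant_def by blast
  have "f \<tau> = a" if "\<tau> \<in> U" for \<tau> using bspec[OF U(3) that] \<sigma> by simp
  then have "U \<subseteq> {\<sigma> \<in> arrows \<Sigma>. f \<sigma> = a}" using openin_subset[OF U(1)] by blast
  then show "\<exists>T. openin (gtop \<Sigma>) T \<and> \<sigma> \<in> T \<and> T \<subseteq> {\<sigma> \<in> arrows \<Sigma>. f \<sigma> = a}" using U by blast
qed

text \<open>
  The zero set of a locally constant function is open and, by contravariance, a union of fibres of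
  the open map \<open>q\<close>.
\<close>

lemma closed_suppG:
  assumes cl: "\<And>\<sigma>. \<sigma> \<in> arrows \<Sigma> \<Longrightarrow> f \<sigma> \<in> carrier R"
    and contra: "\<And>t \<sigma>. t \<in> Units R \<Longrightarrow> \<sigma> \<in> arrows \<Sigma> \<Longrightarrow> f (t \<cdot> \<sigma>) = inv\<^bsub>R\<^esub> t \<otimes>\<^bsub>R\<^esub> f \<sigma>"
    and lc: "locally_constant (gtop \<Sigma>) f"
  shows "closedin (gtop G) (suppG R \<Sigma> q f)"
proof -
  note supp_iff = q_in_suppG_iff[of f, OF cl contra]
  let ?Z = "{\<sigma> \<in> arrows \<Sigma>. f \<sigma> = \<zero>\<^bsub>R\<^esub>}"
  have "openin (gtop \<Sigma>) ?Z" by (rule open_level_set[OF lc])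
  then have "openin (gtop G) (q ` ?Z)" by (rule q_open)
  moreover have "q ` ?Z = arrows G - suppG R \<Sigma> q f"
  proof (intro equalityI subsetI)
    fix \<alpha> assume "\<alpha> \<in> q ` ?Z"
    then show "\<alpha> \<in> arrows G - suppG R \<Sigma> q f" using supp_iff by auto
  next
    fix \<alpha> assume \<alpha>: "\<alpha> \<in> arrows G - suppG R \<Sigma> q f"
    then obtain \<sigma> where "\<sigma> \<in> arrows \<Sigma>" "\<alpha> = q \<sigma>" using q_surj by blast
    then show "\<alpha> \<in> q ` ?Z" using \<alpha> supp_iff by blast
  qed
  moreover have "suppG R \<Sigma> q f \<subseteq> arrows G" unfolding suppG_def by auto
  ultimately show ?thesis by (simp add: closedin_def)
qed

lemma steinbergI:
  assumes "\<And>\<sigma>. \<sigma> \<in> arrows \<Sigma> \<Longrightarrow> f \<sigma> \<in> carrier R" "f \<in> extensional (arrows \<Sigma>)"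
    and "\<And>t \<sigma>. t \<in> Units R \<Longrightarrow> \<sigma> \<in> arrows \<Sigma> \<Longrightarrow> f (t \<cdot> \<sigma>) = inv\<^bsub>R\<^esub> t \<otimes>\<^bsub>R\<^esub> f \<sigma>"
    and "locally_constant (gtop \<Sigma>) f"
    and "suppG R \<Sigma> q f \<subseteq> C" "compactin (gtop G) C"
  shows "f \<in> steinberg"
  using closed_compactin[OF assms(6,5) closed_suppG[OF assms(1,3,4)]] assms(1-4)
  unfolding steinberg_functions_def by (auto simp: PiE_def)

lemma steinberg_supp_iff:
  assumes "f \<in> steinberg" "\<sigma> \<in> arrows \<Sigma>"
  shows "q \<sigma> \<in> suppG R \<Sigma> q f \<longleftrightarrow> f \<sigma> \<noteq> \<zero>\<^bsub>R\<^esub>"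
  by (rule q_in_suppG_iff[OF _ _ assms(2)]) (use steinbergD(1,4)[OF assms(1)] in auto)

text \<open>
  A common form of differences and scalar multiples; homogeneity of \<open>\<phi>\<close> under units keeps
  contravariance.
\<close>

lemma steinberg_pointwise:
  assumes f: "f \<in> steinberg" and g: "g \<in> steinberg"
    and cl: "\<And>a b. a \<in> carrier R \<Longrightarrow> b \<in> carrier R \<Longrightarrow> \<phi> a b \<in> carrier R"
    and zero: "\<phi> \<zero>\<^bsub>R\<^esub> \<zero>\<^bsub>R\<^esub> = \<zero>\<^bsub>R\<^esub>"
    and unit: "\<And>t a b. t \<in> Units R \<Longrightarrow> a \<in> carrier R \<Longrightarrow> b \<in> carrier R \<Longrightarrow>
      \<phi> (t \<otimes>\<^bsub>R\<^esub> a) (t \<otimes>\<^bsub>R\<^esub> b) = t \<otimes>\<^bsub>R\<^esub> \<phi> a b"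
  shows "(\<lambda>\<sigma>\<in>arrows \<Sigma>. \<phi> (f \<sigma>) (g \<sigma>)) \<in> steinberg"
proof (rule steinbergI)
  let ?h = "\<lambda>\<sigma>\<in>arrows \<Sigma>. \<phi> (f \<sigma>) (g \<sigma>)"
  show "?h \<sigma> \<in> carrier R" if "\<sigma> \<in> arrows \<Sigma>" for \<sigma>
    using that cl steinbergD(1)[OF f] steinbergD(1)[OF g] by simp
  show "?h (t \<cdot> \<sigma>) = inv\<^bsub>R\<^esub> t \<otimes>\<^bsub>R\<^esub> ?h \<sigma>" if "t \<in> Units R" "\<sigma> \<in> arrows \<Sigma>" for t \<sigma>
    using that steinbergD(1,4)[OF f] steinbergD(1,4)[OF g] by (simp add: unit)
  show "locally_constant (gtop \<Sigma>) ?h"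
    unfolding locally_constant_def
  proof
    fix \<sigma> assume \<sigma>: "\<sigma> \<in> arrows \<Sigma>"
    obtain U where U: "openin (gtop \<Sigma>) U" "\<sigma> \<in> U" "\<forall>\<tau> \<in> U. f \<tau> = f \<sigma>"
      using steinbergD(3)[OF f] \<sigma> unfolding locally_constant_def by blast
    obtain V where V: "openin (gtop \<Sigma>) V" "\<sigma> \<in> V" "\<forall>\<tau> \<in> V. g \<tau> = g \<sigma>"
      using steinbergD(3)[OF g] \<sigma> unfolding locally_constant_def by blast
    have "U \<subseteq> arrows \<Sigma>" using U(1) openin_subset by blast
    then have "?h \<tau> = ?h \<sigma>" if "\<tau> \<in> U \<inter> V" for \<tau>
      using that bspec[OF U(3), of \<tau>] bspec[OF V(3), of \<tau>] \<sigma> by auto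
    moreover have "openin (gtop \<Sigma>) (U \<inter> V)" using U(1) V(1) by (rule openin_Int)
    ultimately show "\<exists>W. openin (gtop \<Sigma>) W \<and> \<sigma> \<in> W \<and> (\<forall>\<tau> \<in> W. ?h \<tau> = ?h \<sigma>)"
      using U(2) V(2) by blast
  qed
  show "suppG R \<Sigma> q ?h \<subseteq> suppG R \<Sigma> q f \<union> suppG R \<Sigma> q g"
  proof -
    have "{\<sigma> \<in> arrows \<Sigma>. ?h \<sigma> \<noteq> \<zero>\<^bsub>R\<^esub>} \<subseteq>
        {\<sigma> \<in> arrows \<Sigma>. f \<sigma> \<noteq> \<zero>\<^bsub>R\<^esub>} \<union> {\<sigma> \<in> arrows \<Sigma>. g \<sigma> \<noteq> \<zero>\<^bsub>R\<^esub>}"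
      by (auto simp: zero)
    then show ?thesis unfolding suppG_def by (simp add: image_mono flip: image_Un)
  qed
  show "compactin (gtop G) (suppG R \<Sigma> q f \<union> suppG R \<Sigma> q g)"
    using steinbergD(5)[OF f] steinbergD(5)[OF g] by (rule compactin_Un)
qed simp

definition restrict_support :: "'g set \<Rightarrow> ('s \<Rightarrow> 'r) \<Rightarrow> 's \<Rightarrow> 'r" where
  "restrict_support S f = (\<lambda>\<sigma>\<in>arrows \<Sigma>. if q \<sigma> \<in> S then f \<sigma> else \<zero>\<^bsub>R\<^esub>)"

lemma suppG_restrict_support: "suppG R \<Sigma> q (restrict_support S f) = suppG R \<Sigma> q f \<inter> S"
  unfolding suppG_def restrict_support_def by auto

lemma restrict_support_steinberg:
  assumes f: "f \<in> steinberg" and S: "openin (gtop G) S" "closedin (gtop G) S"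
  shows "restrict_support S f \<in> steinberg"
proof (rule steinbergI)
  show "restrict_support S f \<sigma> \<in> carrier R" if "\<sigma> \<in> arrows \<Sigma>" for \<sigma>
    using that steinbergD(1)[OF f] by (simp add: restrict_support_def)
  show "restrict_support S f (t \<cdot> \<sigma>) = inv\<^bsub>R\<^esub> t \<otimes>\<^bsub>R\<^esub> restrict_support S f \<sigma>" if "t \<in> Units R" "\<sigma> \<in> arrows \<Sigma>" for t \<sigma>
    using that steinbergD(1,4)[OF f] by (simp add: restrict_support_def)
  show "locally_constant (gtop \<Sigma>) (restrict_support S f)"
    unfolding locally_constant_def
  proof
    fix \<sigma> assume \<sigma>: "\<sigma> \<in> arrows \<Sigma>"
    obtain U where U: "openin (gtop \<Sigma>) U" "\<sigma> \<in> U" "\<forall>\<tau> \<in> U. f \<tau> = f \<sigma>"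
      using steinbergD(3)[OF f] \<sigma> unfolding locally_constant_def by blast
    have Us: "U \<subseteq> arrows \<Sigma>" using U(1) openin_subset by blast
    define S' where "S' = (if q \<sigma> \<in> S then S else arrows G - S)"
    have "openin (gtop G) S'" using S by (simp add: S'_def closedin_def)
    then have "openin (gtop \<Sigma>) {\<tau> \<in> U. q \<tau> \<in> S'}"
      by (rule openin_continuous_map_preimage_gen[OF continuous_q U(1)])
    moreover have "\<sigma> \<in> {\<tau> \<in> U. q \<tau> \<in> S'}" using U(2) \<sigma> by (simp add: S'_def)
    moreover have "restrict_support S f \<tau> = restrict_support S f \<sigma>" if "\<tau> \<in> {\<tau> \<in> U. q \<tau> \<in> S'}" for \<tau>
    proof -
      have "\<tau> \<in> arrows \<Sigma>" "f \<tau> = f \<sigma>" "q \<tau> \<in> S \<longleftrightarrow> q \<sigma> \<in> S"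
        using that Us bspec[OF U(3)] by (auto simp: S'_def split: if_splits)
      then show ?thesis using \<sigma> by (simp add: restrict_support_def)
    qed
    ultimately show "\<exists>W. openin (gtop \<Sigma>) W \<and> \<sigma> \<in> W \<and> (\<forall>\<tau> \<in> W. restrict_support S f \<tau> = restrict_support S f \<sigma>)"
      by blast
  qed
  show "suppG R \<Sigma> q (restrict_support S f) \<subseteq> suppG R \<Sigma> q f" by (simp add: suppG_restrict_support)
qed (use steinbergD(5)[OF f] in \<open>auto simp: restrict_support_def\<close>)

lemma tilde_scale:
  assumes X: "X \<subseteq> arrows \<Sigma>" "inj_on q X" and \<tau>: "\<tau> \<in> X" and t: "t \<in> Units R"
  shows "tilde X (t \<cdot> \<tau>) = inv\<^bsub>R\<^esub> t"
proof -
  have \<tau>a: "\<tau> \<in> arrows \<Sigma>" using X(1) \<tau> by blast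
  have "u = t" if u: "u \<in> Units R" "t \<cdot> \<tau> \<in> (\<lambda>\<sigma>. u \<cdot> \<sigma>) ` X" for u
  proof -
    obtain \<rho> where \<rho>: "\<rho> \<in> X" "t \<cdot> \<tau> = u \<cdot> \<rho>" using u(2) by blast
    then have "q \<tau> = q \<rho>" using q_scale[OF \<tau>a t] q_scale[of \<rho> u] X(1) u(1) by auto
    then have "\<tau> = \<rho>" using inj_onD[OF X(2)] \<tau> \<rho>(1) by blast
    then show ?thesis using scale_inj[OF \<tau>a t u(1)] \<rho>(2) by simp
  qed
  then have "(THE u. u \<in> Units R \<and> t \<cdot> \<tau> \<in> (\<lambda>\<sigma>. u \<cdot> \<sigma>) ` X) = t"
    using t \<tau> by (intro the_equality) auto
  moreover have "\<exists>u \<in> Units R. t \<cdot> \<tau> \<in> (\<lambda>\<sigma>. u \<cdot> \<sigma>) ` X" using t \<tau> by blast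
  ultimately show ?thesis using \<tau>a t by (simp add: tilde_indicator_def)
qed

lemma tilde_on:
  assumes "X \<subseteq> arrows \<Sigma>" "inj_on q X" "\<tau> \<in> X"
  shows "tilde X \<tau> = \<one>\<^bsub>R\<^esub>"
  using tilde_scale[OF assms R.Units_one_closed] scale_one[of \<tau>] assms by auto

lemma tilde_off:
  assumes "X \<subseteq> arrows \<Sigma>" "\<sigma> \<in> arrows \<Sigma>" "q \<sigma> \<notin> q ` X"
  shows "tilde X \<sigma> = \<zero>\<^bsub>R\<^esub>"
proof -
  have "\<not> (\<exists>t \<in> Units R. \<sigma> \<in> (\<lambda>\<sigma>. t \<cdot> \<sigma>) ` X)"
  proof
    assume "\<exists>t \<in> Units R. \<sigma> \<in> (\<lambda>\<sigma>. t \<cdot> \<sigma>) ` X"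
    then obtain t \<tau> where t: "t \<in> Units R" "\<tau> \<in> X" "\<sigma> = t \<cdot> \<tau>" by blast
    then have "q \<sigma> = q \<tau>" using assms(1) q_scale[of \<tau> t] by blast
    then show False using t(2) assms(3) by blast
  qed
  then show ?thesis using assms(2) by (simp add: tilde_indicator_def)
qed

lemma over_section_cases:
  assumes "X \<subseteq> arrows \<Sigma>" "\<sigma> \<in> arrows \<Sigma>" "q \<sigma> \<in> q ` X"
  obtains t \<tau> where "t \<in> Units R" "\<tau> \<in> X" "\<sigma> = t \<cdot> \<tau>"
proof -
  obtain \<tau> where \<tau>: "\<tau> \<in> X" "q \<sigma> = q \<tau>" using assms(3) by blast
  then obtain t where "t \<in> Units R" "\<sigma> = t \<cdot> \<tau>"
    using same_fibre_imp_scale[of \<tau> \<sigma>] assms(1,2) by (metis subsetD)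
  then show ?thesis using that \<tau>(1) by blast
qed

text \<open>
  The indicator is constant on each translate \<open>t \<cdot> X\<close>, which is open. Off these translates it
  vanishes, and their union is closed because \<open>q ` X\<close> is compact in the Hausdorff space
  \<open>G\<close>.
\<close>

lemma tilde_steinberg:
  assumes X: "openin (gtop \<Sigma>) X" "compactin (gtop \<Sigma>) X" "inj_on q X"
  shows "tilde X \<in> steinberg"
proof (rule steinbergI)
  have Xs: "X \<subseteq> arrows \<Sigma>" using X(1) openin_subset by blast
  show "tilde X \<sigma> \<in> carrier R" if \<sigma>: "\<sigma> \<in> arrows \<Sigma>" for \<sigma>
  proof (cases "q \<sigma> \<in> q ` X")
    case True
    then obtain t \<tau> where "t \<in> Units R" "\<tau> \<in> X" "\<sigma> = t \<cdot> \<tau>"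
      using over_section_cases[OF Xs \<sigma>] by metis
    then show ?thesis using tilde_scale[OF Xs X(3)] by simp
  qed (simp add: tilde_off[OF Xs \<sigma>])
  show "tilde X \<in> extensional (arrows \<Sigma>)" by (simp add: tilde_indicator_def)
  show "tilde X (t \<cdot> \<sigma>) = inv\<^bsub>R\<^esub> t \<otimes>\<^bsub>R\<^esub> tilde X \<sigma>" if t: "t \<in> Units R" and \<sigma>: "\<sigma> \<in> arrows \<Sigma>" for t \<sigma>
  proof (cases "q \<sigma> \<in> q ` X")
    case True
    then obtain u \<tau> where u: "u \<in> Units R" "\<tau> \<in> X" "\<sigma> = u \<cdot> \<tau>"
      using over_section_cases[OF Xs \<sigma>] by metis
    then have "t \<cdot> \<sigma> = (t \<otimes>\<^bsub>R\<^esub> u) \<cdot> \<tau>" using scale_scale t Xs by auto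
    then have "tilde X (t \<cdot> \<sigma>) = inv\<^bsub>R\<^esub> (t \<otimes>\<^bsub>R\<^esub> u)"
      using tilde_scale[OF Xs X(3) u(2)] t u(1) by simp
    also have "\<dots> = inv\<^bsub>R\<^esub> t \<otimes>\<^bsub>R\<^esub> inv\<^bsub>R\<^esub> u"
    proof (rule R.comm_inv_char)
      note c = R.Units_closed[OF t] R.Units_closed[OF u(1)]
        R.Units_inv_closed[OF t] R.Units_inv_closed[OF u(1)]
      have "(t \<otimes>\<^bsub>R\<^esub> u) \<otimes>\<^bsub>R\<^esub> (inv\<^bsub>R\<^esub> t \<otimes>\<^bsub>R\<^esub> inv\<^bsub>R\<^esub> u) =
          (t \<otimes>\<^bsub>R\<^esub> inv\<^bsub>R\<^esub> t) \<otimes>\<^bsub>R\<^esub> (u \<otimes>\<^bsub>R\<^esub> inv\<^bsub>R\<^esub> u)"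
        using c by (simp add: R.m_ac)
      then show "(t \<otimes>\<^bsub>R\<^esub> u) \<otimes>\<^bsub>R\<^esub> (inv\<^bsub>R\<^esub> t \<otimes>\<^bsub>R\<^esub> inv\<^bsub>R\<^esub> u) = \<one>\<^bsub>R\<^esub>"
        using t u(1) by simp
    qed (use t u(1) in \<open>simp_all add: R.Units_closed\<close>)
    finally show ?thesis using tilde_scale[OF Xs X(3) u(2,1)] u(3) by simp
  next
    case False
    then show ?thesis using tilde_off[OF Xs] t \<sigma> by simp
  qed
  show "locally_constant (gtop \<Sigma>) (tilde X)"
    unfolding locally_constant_def
  proof
    fix \<sigma> assume \<sigma>: "\<sigma> \<in> arrows \<Sigma>"
    show "\<exists>U. openin (gtop \<Sigma>) U \<and> \<sigma> \<in> U \<and> (\<forall>\<tau> \<in> U. tilde X \<tau> = tilde X \<sigma>)"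
    proof (cases "q \<sigma> \<in> q ` X")
      case True
      then obtain t \<tau> where t: "t \<in> Units R" "\<tau> \<in> X" "\<sigma> = t \<cdot> \<tau>"
        using over_section_cases[OF Xs \<sigma>] by metis
      have "\<forall>\<rho> \<in> (\<lambda>\<sigma>. t \<cdot> \<sigma>) ` X. tilde X \<rho> = tilde X \<sigma>"
        using tilde_scale[OF Xs X(3) _ t(1)] t(2,3) by auto
      then show ?thesis using open_scale_image[OF X(1) t(1)] t(2,3) by blast
    next
      case False
      have "closedin (gtop G) (q ` X)"
        by (rule compactin_imp_closedin[OF Hausdorff_base image_compactin[OF X(2) continuous_q]])
      then have "openin (gtop G) (arrows G - q ` X)" by blast
      from openin_continuous_map_preimage[OF continuous_q this]
      have "openin (gtop \<Sigma>) {\<tau> \<in> arrows \<Sigma>. q \<tau> \<in> arrows G - q ` X}" .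
      then show ?thesis using False \<sigma> tilde_off[OF Xs]
        by (intro exI[of _ "{\<tau> \<in> arrows \<Sigma>. q \<tau> \<in> arrows G - q ` X}"]) auto
    qed
  qed
  show "suppG R \<Sigma> q (tilde X) \<subseteq> q ` X"
    unfolding suppG_def using tilde_off[OF Xs] by blast
  show "compactin (gtop G) (q ` X)" by (rule image_compactin[OF X(2) continuous_q])
qed


section \<open>Convolution with indicator functions\<close>

text \<open>
  The scalars that contravariance moves out of the two factors are inverse to each other. Hence a
  convolution sum may be computed with any convenient lift of an arrow of \<open>G\<close>.
\<close>

lemma convolution_term_fibre:
  assumes f: "f \<in> steinberg" and g: "g \<in> steinberg"
    and arr: "\<tau> \<in> arrows \<Sigma>" "\<tau>' \<in> arrows \<Sigma>" "\<sigma> \<in> arrows \<Sigma>" and eq: "q \<tau>' = q \<tau>"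
    and r: "range_of G (q \<tau>) = range_of G (q \<sigma>)"
  shows "f \<tau>' \<otimes>\<^bsub>R\<^esub> g (ginv \<Sigma> \<tau>' \<star>\<^bsub>\<Sigma>\<^esub> \<sigma>) = f \<tau> \<otimes>\<^bsub>R\<^esub> g (ginv \<Sigma> \<tau> \<star>\<^bsub>\<Sigma>\<^esub> \<sigma>)"
proof -
  obtain t where t: "t \<in> Units R" "\<tau>' = t \<cdot> \<tau>"
    using same_fibre_imp_scale[OF arr(1,2)] eq by metis
  note u = R.Units_inv_Units[OF t(1)]
  have c: "(ginv \<Sigma> \<tau>, \<sigma>) \<in> composable \<Sigma>"
    using arr r \<Sigma>.inv_closed by (simp add: composable_iff_q q_inv G.source_inv)
  have cl: "f \<tau> \<in> carrier R" "g (ginv \<Sigma> \<tau> \<star>\<^bsub>\<Sigma>\<^esub> \<sigma>) \<in> carrier R"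
    using steinbergD(1)[OF f] steinbergD(1)[OF g] arr \<Sigma>.mult_closed[OF c] by auto
  have "ginv \<Sigma> \<tau>' \<star>\<^bsub>\<Sigma>\<^esub> \<sigma> = inv\<^bsub>R\<^esub> t \<cdot> (ginv \<Sigma> \<tau> \<star>\<^bsub>\<Sigma>\<^esub> \<sigma>)"
    using t inv_scale[OF arr(1) t(1)] scale_mult_left[OF c u] by simp
  then have g': "g (ginv \<Sigma> \<tau>' \<star>\<^bsub>\<Sigma>\<^esub> \<sigma>) = t \<otimes>\<^bsub>R\<^esub> g (ginv \<Sigma> \<tau> \<star>\<^bsub>\<Sigma>\<^esub> \<sigma>)"
    using steinbergD(4)[OF g u \<Sigma>.mult_closed[OF c]] t(1) by simp
  have f': "f \<tau>' = inv\<^bsub>R\<^esub> t \<otimes>\<^bsub>R\<^esub> f \<tau>" using steinbergD(4)[OF f t(1) arr(1)] t(2) by simp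
  have tc: "t \<in> carrier R" "inv\<^bsub>R\<^esub> t \<in> carrier R" using t(1) by (simp_all add: R.Units_closed)
  have "(inv\<^bsub>R\<^esub> t \<otimes>\<^bsub>R\<^esub> f \<tau>) \<otimes>\<^bsub>R\<^esub> (t \<otimes>\<^bsub>R\<^esub> g (ginv \<Sigma> \<tau> \<star>\<^bsub>\<Sigma>\<^esub> \<sigma>)) =
      (inv\<^bsub>R\<^esub> t \<otimes>\<^bsub>R\<^esub> t) \<otimes>\<^bsub>R\<^esub> (f \<tau> \<otimes>\<^bsub>R\<^esub> g (ginv \<Sigma> \<tau> \<star>\<^bsub>\<Sigma>\<^esub> \<sigma>))"
    using cl tc by (simp add: R.m_ac)
  then show ?thesis using f' g' cl t(1) by simp
qed

lemma section_arrow: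
  assumes "\<alpha> \<in> arrows G"
  shows "inv_into (arrows \<Sigma>) q \<alpha> \<in> arrows \<Sigma>" "q (inv_into (arrows \<Sigma>) q \<alpha>) = \<alpha>"
  using assms q_surj inv_into_into[of \<alpha> q "arrows \<Sigma>"] f_inv_into_f[of \<alpha> q "arrows \<Sigma>"] by auto

lemma convolution_term_closed:
  assumes f: "f \<in> steinberg" and g: "g \<in> steinberg" and \<alpha>: "\<alpha> \<in> arrows G" and \<sigma>: "\<sigma> \<in> arrows \<Sigma>"
    and r: "range_of G \<alpha> = range_of G (q \<sigma>)"
  shows "(ginv \<Sigma> (inv_into (arrows \<Sigma>) q \<alpha>), \<sigma>) \<in> composable \<Sigma>"
    "f (inv_into (arrows \<Sigma>) q \<alpha>) \<otimes>\<^bsub>R\<^esub> g (ginv \<Sigma> (inv_into (arrows \<Sigma>) q \<alpha>) \<star>\<^bsub>\<Sigma>\<^esub> \<sigma>) \<in> carrier R"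
proof -
  note S = section_arrow[OF \<alpha>]
  show c: "(ginv \<Sigma> (inv_into (arrows \<Sigma>) q \<alpha>), \<sigma>) \<in> composable \<Sigma>"
    using S \<sigma> r \<alpha> \<Sigma>.inv_closed by (simp add: composable_iff_q q_inv G.source_inv)
  show "f (inv_into (arrows \<Sigma>) q \<alpha>) \<otimes>\<^bsub>R\<^esub> g (ginv \<Sigma> (inv_into (arrows \<Sigma>) q \<alpha>) \<star>\<^bsub>\<Sigma>\<^esub> \<sigma>) \<in> carrier R"
    using steinbergD(1)[OF f S(1)] steinbergD(1)[OF g \<Sigma>.mult_closed[OF c]] by simp
qed

lemma suppG_subset: "suppG R \<Sigma> q f \<subseteq> arrows G"
  unfolding suppG_def by auto

lemma suppG_tilde:
  assumes "X \<subseteq> arrows \<Sigma>" "inj_on q X" "\<one>\<^bsub>R\<^esub> \<noteq> \<zero>\<^bsub>R\<^esub>"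
  shows "suppG R \<Sigma> q (tilde X) = q ` X"
proof
  show "suppG R \<Sigma> q (tilde X) \<subseteq> q ` X"
    unfolding suppG_def using tilde_off[OF assms(1)] by blast
  show "q ` X \<subseteq> suppG R \<Sigma> q (tilde X)"
    unfolding suppG_def using tilde_on[OF assms(1,2)] assms(1,3) by auto
qed

text \<open>
  Left convolution with the indicator of a section translates: \<open>X\<close> meets each range fibre in at
  most one arrow, so at most one summand is present.
\<close>

lemma convolution_section_left:
  assumes X: "openin (gtop \<Sigma>) X" "compactin (gtop \<Sigma>) X" "inj_on q X" "inj_on (range_of G) (q ` X)"
    and one: "\<one>\<^bsub>R\<^esub> \<noteq> \<zero>\<^bsub>R\<^esub>" and g: "g \<in> steinberg" and \<tau>: "\<tau> \<in> X" and \<sigma>: "\<sigma> \<in> arrows \<Sigma>"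
    and r: "range_of \<Sigma> \<tau> = range_of \<Sigma> \<sigma>"
  shows "conv (tilde X) g \<sigma> = g (ginv \<Sigma> \<tau> \<star>\<^bsub>\<Sigma>\<^esub> \<sigma>)"
proof -
  have Xs: "X \<subseteq> arrows \<Sigma>" using X(1) openin_subset by blast
  have \<tau>a: "\<tau> \<in> arrows \<Sigma>" using Xs \<tau> by blast
  have rq: "range_of G (q \<tau>) = range_of G (q \<sigma>)" using r range_eq_iff_q[OF \<tau>a \<sigma>] by simp
  have tX: "tilde X \<in> steinberg" by (rule tilde_steinberg[OF X(1-3)])
  let ?h = "\<lambda>\<alpha>. tilde X (inv_into (arrows \<Sigma>) q \<alpha>)
      \<otimes>\<^bsub>R\<^esub> g (ginv \<Sigma> (inv_into (arrows \<Sigma>) q \<alpha>) \<star>\<^bsub>\<Sigma>\<^esub> \<sigma>)"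
  have "{\<alpha> \<in> suppG R \<Sigma> q (tilde X). range_of G \<alpha> = range_of G (q \<sigma>)} = {q \<tau>}"
  proof (intro equalityI subsetI)
    fix \<alpha> assume "\<alpha> \<in> {\<alpha> \<in> suppG R \<Sigma> q (tilde X). range_of G \<alpha> = range_of G (q \<sigma>)}"
    then have "\<alpha> \<in> q ` X" "range_of G \<alpha> = range_of G (q \<tau>)"
      using suppG_tilde[OF Xs X(3) one] rq by simp_all
    then show "\<alpha> \<in> {q \<tau>}" using inj_onD[OF X(4), of \<alpha> "q \<tau>"] \<tau> by blast
  qed (use suppG_tilde[OF Xs X(3) one] rq \<tau> in simp)
  then have "conv (tilde X) g \<sigma> = (\<Oplus>\<^bsub>R\<^esub>\<alpha>\<in>{q \<tau>}. ?h \<alpha>)"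
    using \<sigma> by (simp add: convolution_def Let_def)
  also have "\<dots> = ?h (q \<tau>)"
    using convolution_term_closed(2)[OF tX g q_closed[OF \<tau>a] \<sigma> rq] by (simp add: R.finsum_insert)
  also have "\<dots> = tilde X \<tau> \<otimes>\<^bsub>R\<^esub> g (ginv \<Sigma> \<tau> \<star>\<^bsub>\<Sigma>\<^esub> \<sigma>)"
    using section_arrow[OF q_closed[OF \<tau>a]]
    by (intro convolution_term_fibre[OF tX g \<tau>a _ \<sigma> _ rq])
  also have "\<dots> = g (ginv \<Sigma> \<tau> \<star>\<^bsub>\<Sigma>\<^esub> \<sigma>)"
  proof -
    have "(ginv \<Sigma> \<tau>, \<sigma>) \<in> composable \<Sigma>"
      using \<tau>a \<sigma> rq \<Sigma>.inv_closed by (simp add: composable_iff_q q_inv G.source_inv)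
    then show ?thesis
      using tilde_on[OF Xs X(3) \<tau>] steinbergD(1)[OF g \<Sigma>.mult_closed] by simp
  qed
  finally show ?thesis .
qed

lemma convolution_section_left_off:
  assumes X: "X \<subseteq> arrows \<Sigma>" and \<sigma>: "\<sigma> \<in> arrows \<Sigma>"
    and off: "range_of \<Sigma> \<sigma> \<notin> range_of \<Sigma> ` X"
  shows "conv (tilde X) g \<sigma> = \<zero>\<^bsub>R\<^esub>"
proof -
  have sub: "suppG R \<Sigma> q (tilde X) \<subseteq> q ` X"
    unfolding suppG_def using tilde_off[OF X] by blast
  have "range_of G (q \<tau>) \<noteq> range_of G (q \<sigma>)" if "\<tau> \<in> X" for \<tau>
    using off that X \<sigma> range_eq_iff_q[of \<tau> \<sigma>] by (metis image_eqI subsetD)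
  then have "{\<alpha> \<in> suppG R \<Sigma> q (tilde X). range_of G \<alpha> = range_of G (q \<sigma>)} = {}"
    using sub by blast
  then show ?thesis
    using \<sigma> by (simp only: convolution_def Let_def restrict_apply' R.finsum_empty)
qed

text \<open>
  Right convolution with the indicator of a set of units restricts the source: the summand at
  \<open>\<alpha>\<close> involves the indicator at an arrow over \<open>\<alpha>\<^sup>-\<^sup>1 q(\<sigma>)\<close>, which is a unit only for
  \<open>\<alpha> = q \<sigma>\<close>.
\<close>

lemma convolution_units_right:
  assumes f: "f \<in> steinberg"
    and K: "openin (gtop \<Sigma>) K" "compactin (gtop \<Sigma>) K" "K \<subseteq> unit_space \<Sigma>"
  shows "conv f (tilde K) = restrict_support {\<alpha> \<in> arrows G. source_of G \<alpha> \<in> q ` K} f"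
proof (rule extensionalityI[of _ "arrows \<Sigma>"])
  fix \<sigma> assume \<sigma>: "\<sigma> \<in> arrows \<Sigma>"
  have Ks: "K \<subseteq> arrows \<Sigma>" using K(1) openin_subset by blast
  have injK: "inj_on q K" using q_inj_units K(3) by (rule inj_on_subset)
  have tK: "tilde K \<in> steinberg" by (rule tilde_steinberg[OF K(1,2) injK])
  let ?S = "inv_into (arrows \<Sigma>) q"
  let ?h = "\<lambda>\<alpha>. f (?S \<alpha>) \<otimes>\<^bsub>R\<^esub> tilde K (ginv \<Sigma> (?S \<alpha>) \<star>\<^bsub>\<Sigma>\<^esub> \<sigma>)"
  let ?A = "{\<alpha> \<in> suppG R \<Sigma> q f. range_of G \<alpha> = range_of G (q \<sigma>)}"
  let ?v = "if source_of G (q \<sigma>) \<in> q ` K then f \<sigma> else \<zero>\<^bsub>R\<^esub>"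
  have v: "?v \<in> carrier R" using steinbergD(1)[OF f \<sigma>] by simp
  have fin: "finite ?A" by (rule G.finite_compact_range_fibre[OF steinbergD(5)[OF f]])
  have term_eq: "?h \<alpha> = (if q \<sigma> = \<alpha> then ?v else \<zero>\<^bsub>R\<^esub>)" if "\<alpha> \<in> ?A" for \<alpha>
  proof -
    have \<alpha>: "\<alpha> \<in> arrows G" "range_of G \<alpha> = range_of G (q \<sigma>)" using that suppG_subset by auto
    note S = section_arrow[OF \<alpha>(1)]
    show ?thesis
    proof (cases "q \<sigma> = \<alpha>")
      case True
      have "?h \<alpha> = f \<sigma> \<otimes>\<^bsub>R\<^esub> tilde K (source_of \<Sigma> \<sigma>)"
        using convolution_term_fibre[OF f tK \<sigma> S(1) \<sigma>] S(2) True by (simp add: source_of_def)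
      also have "\<dots> = ?v"
      proof (cases "source_of G (q \<sigma>) \<in> q ` K")
        case t: True
        then have "source_of \<Sigma> \<sigma> \<in> K"
          using q_source[OF \<sigma>] inj_onD[OF q_inj_units _ \<Sigma>.source_unit[OF \<sigma>]] K(3)
          by (metis imageE subsetD)
        then show ?thesis using t tilde_on[OF Ks injK] steinbergD(1)[OF f \<sigma>] by simp
      next
        case False
        then show ?thesis
          using tilde_off[OF Ks \<Sigma>.source_closed[OF \<sigma>]] q_source[OF \<sigma>] steinbergD(1)[OF f \<sigma>] by simp
      qed
      finally show ?thesis using True by simp
    next
      case False
      note c = convolution_term_closed(1)[OF f tK \<alpha>(1) \<sigma> \<alpha>(2)]
      have "q (ginv \<Sigma> (?S \<alpha>) \<star>\<^bsub>\<Sigma>\<^esub> \<sigma>) \<notin> q ` K"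
      proof
        assume "q (ginv \<Sigma> (?S \<alpha>) \<star>\<^bsub>\<Sigma>\<^esub> \<sigma>) \<in> q ` K"
        then have "ginv G \<alpha> \<star>\<^bsub>G\<^esub> q \<sigma> \<in> unit_space G"
          using q_mult[OF c] q_inv[OF S(1)] S(2) q_unit K(3) by auto
        then have "q \<sigma> = ginv G (ginv G \<alpha>)"
          using G.inv_unique q_composable[OF c] q_inv[OF S(1)] S(2) by simp
        then show False using False G.inv_inv[OF \<alpha>(1)] by simp
      qed
      then show ?thesis
        using tilde_off[OF Ks \<Sigma>.mult_closed[OF c]] steinbergD(1)[OF f S(1)] False by simp
    qed
  qed
  have "conv f (tilde K) \<sigma> = (\<Oplus>\<^bsub>R\<^esub>\<alpha>\<in>?A. ?h \<alpha>)" using \<sigma> by (simp add: convolution_def Let_def)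
  also have "\<dots> = (\<Oplus>\<^bsub>R\<^esub>\<alpha>\<in>?A. if q \<sigma> = \<alpha> then ?v else \<zero>\<^bsub>R\<^esub>)"
    by (rule R.finsum_cong') (use v term_eq in auto)
  also have "\<dots> = (if q \<sigma> \<in> ?A then ?v else \<zero>\<^bsub>R\<^esub>)"
  proof (cases "q \<sigma> \<in> ?A")
    case True
    then show ?thesis
      using R.finsum_singleton[OF True fin, of "\<lambda>_. ?v"] v by simp
  next
    case False
    then have "(\<Oplus>\<^bsub>R\<^esub>\<alpha>\<in>?A. if q \<sigma> = \<alpha> then ?v else \<zero>\<^bsub>R\<^esub>) = \<zero>\<^bsub>R\<^esub>"
      by (intro R.add.finprod_one_eqI) auto
    then show ?thesis using False by simp
  qed
  also have "\<dots> = restrict_support {\<alpha> \<in> arrows G. source_of G \<alpha> \<in> q ` K} f \<sigma>"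
    using \<sigma> steinberg_supp_iff[OF f \<sigma>] by (auto simp: restrict_support_def)
  finally show "conv f (tilde K) \<sigma> = restrict_support {\<alpha> \<in> arrows G. source_of G \<alpha> \<in> q ` K} f \<sigma>" .
qed (simp_all add: convolution_def restrict_support_def)

lemma clopen_source_preimage:
  assumes "openin (gtop \<Sigma>) K" "compactin (gtop \<Sigma>) K"
  shows "openin (gtop G) {\<alpha> \<in> arrows G. source_of G \<alpha> \<in> q ` K}"
    "closedin (gtop G) {\<alpha> \<in> arrows G. source_of G \<alpha> \<in> q ` K}"
proof -
  show "openin (gtop G) {\<alpha> \<in> arrows G. source_of G \<alpha> \<in> q ` K}"
    by (rule openin_continuous_map_preimage[OF G.continuous_source q_open[OF assms(1)]])
  show "closedin (gtop G) {\<alpha> \<in> arrows G. source_of G \<alpha> \<in> q ` K}"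
    by (rule closedin_continuous_map_preimage[OF G.continuous_source
          compactin_imp_closedin[OF Hausdorff_base image_compactin[OF assms(2) continuous_q]]])
qed

end

section \<open>Compressing a homogeneous function to a scalar multiple of a unit indicator\<close>

locale effective_graded_twist =
  ample_twist G R \<Sigma> i q + graded_discrete_twist G R \<Sigma> i q \<Gamma> cG c\<Sigma> + \<Gamma>: group \<Gamma>
  for G :: "('g, 'm) groupoid_scheme" and R :: "('r, 'n) ring_scheme"
    and \<Sigma> :: "('s, 'k) groupoid_scheme" and i :: "'g \<times> 'r \<Rightarrow> 's" and q :: "'s \<Rightarrow> 'g"
    and \<Gamma> :: "('c, 'l) monoid_scheme" and cG :: "'g \<Rightarrow> 'c" and c\<Sigma> :: "'s \<Rightarrow> 'c" +
  assumes effective_identity_part: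
    "effective (restrict_groupoid G (degree_part G cG \<one>\<^bsub>\<Gamma>\<^esub>))"
begin

lemma continuous_degree: "continuous_map (gtop G) (discrete_topology (carrier \<Gamma>)) cG"
  using cG_hom unfolding continuous_groupoid_hom_def discrete_group_groupoid_def by simp

lemma degree_closed: "\<alpha> \<in> arrows G \<Longrightarrow> cG \<alpha> \<in> carrier \<Gamma>"
  using continuous_degree by (auto simp: continuous_map_def Pi_iff)

lemma degree_mult: "(\<alpha>, \<beta>) \<in> composable G \<Longrightarrow> cG (\<alpha> \<star>\<^bsub>G\<^esub> \<beta>) = cG \<alpha> \<otimes>\<^bsub>\<Gamma>\<^esub> cG \<beta>"
  using cG_hom unfolding continuous_groupoid_hom_def discrete_group_groupoid_def by auto

lemma degree_unit:
  assumes "x \<in> unit_space G"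
  shows "cG x = \<one>\<^bsub>\<Gamma>\<^esub>"
proof -
  have x: "x \<in> arrows G" by (rule G.unit_arrow[OF assms])
  have "cG x \<otimes>\<^bsub>\<Gamma>\<^esub> cG x = cG x"
    using degree_mult[OF G.range_mult_self(1)[OF x]] G.range_mult_self(2)[OF x] assms by simp
  then show ?thesis using degree_closed[OF x] by simp
qed

lemma open_degree_part: "openin (gtop G) (degree_part G cG \<gamma>)"
proof (cases "\<gamma> \<in> carrier \<Gamma>")
  case True
  then have "openin (gtop G) {\<alpha> \<in> arrows G. cG \<alpha> \<in> {\<gamma>}}"
    by (intro openin_continuous_map_preimage[OF continuous_degree]) simp
  then show ?thesis by (simp add: degree_part_def)
next
  case False
  then have "degree_part G cG \<gamma> = {}" using degree_closed by (auto simp: degree_part_def)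
  then show ?thesis by simp
qed

lemma clopen_degree_Union:
  "openin (gtop G) (\<Union>\<gamma>\<in>H. degree_part G cG \<gamma>)" "closedin (gtop G) (\<Union>\<gamma>\<in>H. degree_part G cG \<gamma>)"
proof -
  have o: "openin (gtop G) (\<Union>\<gamma>\<in>H. degree_part G cG \<gamma>)" for H
    by (intro openin_Union) (auto intro: open_degree_part)
  show "openin (gtop G) (\<Union>\<gamma>\<in>H. degree_part G cG \<gamma>)" by (rule o)
  have "arrows G - (\<Union>\<gamma>\<in>H. degree_part G cG \<gamma>) = (\<Union>\<gamma>\<in>- H. degree_part G cG \<gamma>)"
    by (auto simp: degree_part_def)
  then have "openin (gtop G) (arrows G - (\<Union>\<gamma>\<in>H. degree_part G cG \<gamma>))" using o by simp
  moreover have "(\<Union>\<gamma>\<in>H. degree_part G cG \<gamma>) \<subseteq> arrows G" by (auto simp: degree_part_def)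
  ultimately show "closedin (gtop G) (\<Union>\<gamma>\<in>H. degree_part G cG \<gamma>)" by (simp add: closedin_def)
qed

text \<open>
  Interiors in the identity component and in \<open>G\<close> agree because the component is open.
\<close>

lemma no_interior_isotropy:
  assumes V: "openin (gtop G) V" "V \<subseteq> degree_part G cG \<one>\<^bsub>\<Gamma>\<^esub> - unit_space G" "V \<subseteq> isotropy G"
  shows "V = {}"
proof -
  let ?D = "degree_part G cG \<one>\<^bsub>\<Gamma>\<^esub>"
  let ?H = "restrict_groupoid G ?D"
  have rs: "range_of ?H a = range_of G a" "source_of ?H a = source_of G a" for a
    by (simp_all add: range_of_def source_of_def restrict_groupoid_def)
  have arr: "arrows ?H = ?D" and top: "gtop ?H = subtopology (gtop G) ?D"
    by (auto simp: restrict_groupoid_def degree_part_def)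
  have "V \<subseteq> gtop ?H interior_of isotropy ?H"
  proof (rule interior_of_maximal)
    show "V \<subseteq> isotropy ?H" using V(2,3) arr rs by (auto simp: isotropy_def)
    show "openin (gtop ?H) V"
      using V(1,2) openin_open_subtopology[OF open_degree_part] unfolding top by blast
  qed
  also have "\<dots> = unit_space ?H" using effective_identity_part by (simp add: effective_def)
  also have "\<dots> \<subseteq> unit_space G"
  proof -
    have "unit_space ?H = range_of G ` ?D"
      unfolding unit_space_def arr by (intro image_cong refl rs)
    then show ?thesis using G.range_unit by (auto simp: degree_part_def)
  qed
  finally show ?thesis using V(2) by blast
qed

text \<open>
  Left translation by a section \<open>X\<^sub>0\<close> through \<open>\<sigma>\<^sub>0\<^sup>-\<^sup>1\<close>, chosen so small that \<open>f\<close> is constant on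
  \<open>X\<^sub>0\<^sup>-\<^sup>1\<close>, turns \<open>f\<close> into a function supported in degree \<open>\<epsilon>\<close> whose value at the units in the
  range of \<open>X\<^sub>0\<close> is \<open>f \<sigma>\<^sub>0\<close>. What remains of its support off the units is a compact set of arrows
  in an open set without interior isotropy. A small \<open>K\<close>, used to cut down both range and source,
  avoids that set, and only the multiple of the indicator of \<open>K\<close> survives. Cutting down the range
  is achieved by shrinking \<open>X\<^sub>0\<close> to \<open>X\<close>, which saves a third factor.
\<close>

lemma compress_homogeneous:
  assumes f: "f \<in> steinberg" and deg: "suppG R \<Sigma> q f \<subseteq> degree_part G cG \<gamma>"
    and \<sigma>0: "\<sigma>0 \<in> arrows \<Sigma>" "f \<sigma>0 \<noteq> \<zero>\<^bsub>R\<^esub>"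
  obtains X K where "openin (gtop \<Sigma>) X" "compactin (gtop \<Sigma>) X" "inj_on q X"
    "openin (gtop \<Sigma>) K" "compactin (gtop \<Sigma>) K" "K \<subseteq> unit_space \<Sigma>" "K \<noteq> {}"
    "conv (tilde X) (conv f (tilde K)) = (\<lambda>\<sigma>\<in>arrows \<Sigma>. f \<sigma>0 \<otimes>\<^bsub>R\<^esub> tilde K \<sigma>)"
proof -
  define r where "r = f \<sigma>0"
  have r: "r \<in> carrier R" "r \<noteq> \<zero>\<^bsub>R\<^esub>" using steinbergD(1)[OF f] \<sigma>0 by (simp_all add: r_def)
  have one: "\<one>\<^bsub>R\<^esub> \<noteq> \<zero>\<^bsub>R\<^esub>" using r R.l_one[OF r(1)] R.l_null[OF r(1)] by metis
  note supp_iff = steinberg_supp_iff[OF f]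

  have "openin (gtop \<Sigma>) {\<tau> \<in> arrows \<Sigma>. ginv \<Sigma> \<tau> \<in> {\<sigma> \<in> arrows \<Sigma>. f \<sigma> = r}}"
    by (rule openin_continuous_map_preimage[OF \<Sigma>.continuous_inv open_level_set[OF steinbergD(3)[OF f]]])
  moreover have "ginv \<Sigma> \<sigma>0 \<in> {\<tau> \<in> arrows \<Sigma>. ginv \<Sigma> \<tau> \<in> {\<sigma> \<in> arrows \<Sigma>. f \<sigma> = r}}"
    using \<sigma>0(1) \<Sigma>.inv_closed \<Sigma>.inv_inv by (simp add: r_def)
  ultimately obtain X0 where X0: "openin (gtop \<Sigma>) X0" "compactin (gtop \<Sigma>) X0" "inj_on q X0"
      "open_bisection G (q ` X0)" "ginv \<Sigma> \<sigma>0 \<in> X0"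
    and X0f: "X0 \<subseteq> {\<tau> \<in> arrows \<Sigma>. ginv \<Sigma> \<tau> \<in> {\<sigma> \<in> arrows \<Sigma>. f \<sigma> = r}}"
    by (rule compact_open_section_basis)
  have X0s: "X0 \<subseteq> arrows \<Sigma>" using X0(1) openin_subset by blast

  \<comment> \<open>The product of the indicator of \<open>X0\<close> with \<open>f\<close> vanishes off the arrows over \<open>D\<close>.\<close>
  define D where "D = {\<alpha> \<star>\<^bsub>G\<^esub> \<beta> | \<alpha> \<beta>. \<alpha> \<in> q ` X0 \<and> \<beta> \<in> suppG R \<Sigma> q f \<and> (\<alpha>, \<beta>) \<in> composable G}"
  have Dc: "compactin (gtop G) D"
    unfolding D_def
    by (rule G.compact_setwise_product[OF Hausdorff_base image_compactin[OF X0(2) continuous_q]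
          steinbergD(5)[OF f]])
  have Ddeg: "D \<subseteq> degree_part G cG \<one>\<^bsub>\<Gamma>\<^esub>"
  proof
    fix \<delta> assume "\<delta> \<in> D"
    then obtain \<tau> \<beta> where \<tau>: "\<tau> \<in> X0" and \<beta>: "\<beta> \<in> suppG R \<Sigma> q f"
      and c: "(q \<tau>, \<beta>) \<in> composable G" and \<delta>: "\<delta> = q \<tau> \<star>\<^bsub>G\<^esub> \<beta>"
      unfolding D_def by blast
    have \<tau>a: "\<tau> \<in> arrows \<Sigma>" and "f (ginv \<Sigma> \<tau>) = r" using X0f \<tau> by auto
    then have "q (ginv \<Sigma> \<tau>) \<in> suppG R \<Sigma> q f" using supp_iff[OF \<Sigma>.inv_closed] r(2) by simp
    then have "cG (ginv G (q \<tau>)) = cG \<beta>"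
      using deg \<beta> q_inv[OF \<tau>a] by (auto simp: degree_part_def)
    then have "cG \<delta> = cG (range_of G (q \<tau>))"
      using degree_mult[OF c] degree_mult[OF G.inv_composable[OF q_closed[OF \<tau>a]]] \<delta>
      by (simp add: range_of_def)
    also have "\<dots> = \<one>\<^bsub>\<Gamma>\<^esub>" by (rule degree_unit[OF G.range_unit[OF q_closed[OF \<tau>a]]])
    finally show "\<delta> \<in> degree_part G cG \<one>\<^bsub>\<Gamma>\<^esub>"
      using G.mult_closed[OF c] \<delta> by (simp add: degree_part_def)
  qed
  \<comment> \<open>A unit in \<open>D\<close> does no harm: there the translated function has the desired value.\<close>
  have D'c: "compactin (gtop G) (D \<inter> (arrows G - unit_space G))"
    by (rule compact_Int_closedin[OF Dc]) (simp add: closedin_diff G.open_unit_space)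
  have Eo: "openin (gtop G) (degree_part G cG \<one>\<^bsub>\<Gamma>\<^esub> - unit_space G)"
    by (rule openin_diff[OF open_degree_part G.closed_unit_space[OF Hausdorff_base]])

  have U0: "openin (gtop G) (range_of G ` q ` X0)"
    by (rule G.bisection_range_open[OF X0(4) q_open[OF X0(1)] subset_refl])
  have U0s: "range_of G ` q ` X0 \<subseteq> unit_space G" using X0s G.range_unit by auto
  have U0ne: "range_of G ` q ` X0 \<noteq> {}" using X0(5) by blast
  have D'E: "D \<inter> (arrows G - unit_space G) \<subseteq> degree_part G cG \<one>\<^bsub>\<Gamma>\<^esub> - unit_space G"
    using Ddeg by blast
  obtain W where W: "openin (gtop G) W" "W \<subseteq> range_of G ` q ` X0" "W \<noteq> {}"
      "\<And>\<beta>. \<beta> \<in> D \<inter> (arrows G - unit_space G) \<Longrightarrow> \<not> (range_of G \<beta> \<in> W \<and> source_of G \<beta> \<in> W)"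
    using G.shrink_off_compact[OF Hausdorff_base D'c Eo D'E no_interior_isotropy U0 U0s U0ne]
    by blast

  obtain \<tau>0 where \<tau>0: "\<tau>0 \<in> X0" "range_of G (q \<tau>0) \<in> W" using W(2,3) by blast
  have "openin (gtop \<Sigma>) {x \<in> unit_space \<Sigma>. q x \<in> W}"
    by (rule openin_continuous_map_preimage_gen[OF continuous_q \<Sigma>.open_unit_space W(1)])
  moreover have "range_of \<Sigma> \<tau>0 \<in> {x \<in> unit_space \<Sigma>. q x \<in> W}"
    using \<tau>0 X0s q_range \<Sigma>.range_unit by auto
  ultimately obtain K where K: "openin (gtop \<Sigma>) K" "compactin (gtop \<Sigma>) K"
      "range_of \<Sigma> \<tau>0 \<in> K" "K \<subseteq> {x \<in> unit_space \<Sigma>. q x \<in> W}"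
    by (rule compact_open_section_basis)
  have Ku: "K \<subseteq> unit_space \<Sigma>" and KW: "q ` K \<subseteq> W" using K(4) by auto
  have Ks: "K \<subseteq> arrows \<Sigma>" using K(1) openin_subset by blast
  have injK: "inj_on q K" using q_inj_units Ku by (rule inj_on_subset)

  define X where "X = {\<tau> \<in> X0. range_of \<Sigma> \<tau> \<in> K}"
  have XX0: "X \<subseteq> X0" by (auto simp: X_def)
  have Xs: "X \<subseteq> arrows \<Sigma>" using XX0 X0s by blast
  have Xo: "openin (gtop \<Sigma>) X"
    unfolding X_def
    by (rule openin_continuous_map_preimage_gen[OF \<Sigma>.continuous_range X0(1) K(1)])
  have "closedin (gtop \<Sigma>) {\<tau> \<in> arrows \<Sigma>. range_of \<Sigma> \<tau> \<in> K}"
    by (rule closedin_continuous_map_preimage[OF \<Sigma>.continuous_range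
          compactin_imp_closedin[OF Hausdorff K(2)]])
  from compact_Int_closedin[OF X0(2) this] have Xc: "compactin (gtop \<Sigma>) X"
    using X0s unfolding X_def by (simp add: Int_def subset_iff conj_ac cong: conj_cong)
  have injX: "inj_on q X" using X0(3) XX0 by (rule inj_on_subset)
  have injrX: "inj_on (range_of G) (q ` X)"
    using G.bisection_range_inj[OF X0(4)] by (rule inj_on_subset) (use XX0 in blast)
  have rX: "k \<in> range_of \<Sigma> ` X" if k: "k \<in> K" for k
  proof -
    obtain \<tau> where \<tau>: "\<tau> \<in> X0" "q k = range_of G (q \<tau>)" using KW W(2) k by blast
    have \<tau>a: "\<tau> \<in> arrows \<Sigma>" using \<tau>(1) X0s by blast
    have "k = range_of \<Sigma> \<tau>"
      using inj_onD[OF q_inj_units, of k "range_of \<Sigma> \<tau>"] k Ku \<Sigma>.range_unit[OF \<tau>a] q_range[OF \<tau>a] \<tau>(2)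
      by auto
    then show ?thesis using \<tau>(1) k by (auto simp: X_def)
  qed

  let ?S = "{\<alpha> \<in> arrows G. source_of G \<alpha> \<in> q ` K}"
  have fK: "conv f (tilde K) = restrict_support ?S f" by (rule convolution_units_right[OF f K(1,2) Ku])
  have fKs: "restrict_support ?S f \<in> steinberg"
    by (rule restrict_support_steinberg[OF f clopen_source_preimage[OF K(1,2)]])
  have "conv (tilde X) (restrict_support ?S f) \<sigma> = r \<otimes>\<^bsub>R\<^esub> tilde K \<sigma>" if \<sigma>: "\<sigma> \<in> arrows \<Sigma>" for \<sigma>
  proof (cases "range_of \<Sigma> \<sigma> \<in> K")
    case False
    then have "range_of \<Sigma> \<sigma> \<notin> range_of \<Sigma> ` X" by (auto simp: X_def)
    then have "conv (tilde X) (restrict_support ?S f) \<sigma> = \<zero>\<^bsub>R\<^esub>"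
      by (rule convolution_section_left_off[OF Xs \<sigma>])
    moreover have "q \<sigma> \<notin> q ` K"
    proof
      assume "q \<sigma> \<in> q ` K"
      then obtain k where k: "k \<in> K" "q \<sigma> = q k" by blast
      then have "range_of \<Sigma> \<sigma> = range_of \<Sigma> k" using range_eq_iff_q[OF \<sigma>, of k] Ks by auto
      then show False using False k(1) Ku by auto
    qed
    ultimately show ?thesis using tilde_off[OF Ks \<sigma>] r(1) by simp
  next
    case True
    then obtain \<tau> where \<tau>: "\<tau> \<in> X" "range_of \<Sigma> \<tau> = range_of \<Sigma> \<sigma>" using rX by force
    have \<tau>a: "\<tau> \<in> arrows \<Sigma>" using \<tau>(1) Xs by blast
    have f\<tau>: "f (ginv \<Sigma> \<tau>) = r" using \<tau>(1) XX0 X0f by blast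
    let ?\<rho> = "ginv \<Sigma> \<tau> \<star>\<^bsub>\<Sigma>\<^esub> \<sigma>"
    have c: "(ginv \<Sigma> \<tau>, \<sigma>) \<in> composable \<Sigma>"
      using \<tau>(2) \<tau>a \<sigma> \<Sigma>.inv_closed by (simp add: \<Sigma>.composable_iff \<Sigma>.source_inv)
    note \<rho> = \<Sigma>.mult_closed[OF c]
    have s\<rho>: "source_of G (q ?\<rho>) = source_of G (q \<sigma>)"
      using \<Sigma>.source_mult[OF c] q_source[OF \<rho>] q_source[OF \<sigma>] by simp
    have "conv (tilde X) (restrict_support ?S f) \<sigma> = restrict_support ?S f ?\<rho>"
      by (rule convolution_section_left[OF Xo Xc injX injrX one fKs \<tau>(1) \<sigma> \<tau>(2)])
    also have "\<dots> = (if source_of G (q \<sigma>) \<in> q ` K then f ?\<rho> else \<zero>\<^bsub>R\<^esub>)"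
      using \<rho> s\<rho> by (simp add: restrict_support_def)
    also have "\<dots> = r \<otimes>\<^bsub>R\<^esub> tilde K \<sigma>"
    \<comment> \<open>Over a unit both sides are the multiple of \<open>r\<close> by one scalar; elsewhere both vanish, since
      otherwise \<open>q \<sigma>\<close> would be an arrow of \<open>D\<close> with both ends in \<open>W\<close>.\<close>
    proof (cases "q \<sigma> \<in> unit_space G")
      case u: True
      let ?k = "range_of \<Sigma> \<sigma>"
      have qk: "q ?k = q \<sigma>" using u q_range[OF \<sigma>] by simp
      obtain t where t: "t \<in> Units R" "\<sigma> = t \<cdot> ?k"
        using same_fibre_imp_scale[OF \<Sigma>.range_closed[OF \<sigma>] \<sigma> qk] by metis
      have ck: "(ginv \<Sigma> \<tau>, ?k) \<in> composable \<Sigma>" "ginv \<Sigma> \<tau> \<star>\<^bsub>\<Sigma>\<^esub> ?k = ginv \<Sigma> \<tau>"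
        using \<Sigma>.mult_source_self[OF \<Sigma>.inv_closed[OF \<tau>a]] \<Sigma>.source_inv[OF \<tau>a] \<tau>(2) by simp_all
      have "?\<rho> = t \<cdot> ginv \<Sigma> \<tau>"
        using scale_mult_right[OF ck(1) t(1)] ck(2) t(2) by metis
      then have "f ?\<rho> = inv\<^bsub>R\<^esub> t \<otimes>\<^bsub>R\<^esub> r"
        using steinbergD(4)[OF f t(1) \<Sigma>.inv_closed[OF \<tau>a]] f\<tau> by simp
      moreover have "source_of G (q \<sigma>) \<in> q ` K" using u qk True by (metis G.source_of_unit imageI)
      moreover have "tilde K \<sigma> = inv\<^bsub>R\<^esub> t"
        using tilde_scale[OF Ks injK True t(1)] t(2)[symmetric] by simp
      ultimately show ?thesis
        using R.m_comm[OF r(1) R.Units_inv_closed[OF t(1)]] by simp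
    next
      case nu: False
      have "q ` K \<subseteq> unit_space G" using q_unit Ku by auto
      then have "q \<sigma> \<notin> q ` K" using nu by auto
      then have "tilde K \<sigma> = \<zero>\<^bsub>R\<^esub>" by (rule tilde_off[OF Ks \<sigma>])
      moreover have "f ?\<rho> = \<zero>\<^bsub>R\<^esub>" if s: "source_of G (q \<sigma>) \<in> q ` K"
      proof (rule ccontr)
        assume "f ?\<rho> \<noteq> \<zero>\<^bsub>R\<^esub>"
        then have \<rho>s: "q ?\<rho> \<in> suppG R \<Sigma> q f" using supp_iff[OF \<rho>] by simp
        have q\<rho>: "q ?\<rho> = ginv G (q \<tau>) \<star>\<^bsub>G\<^esub> q \<sigma>" using q_mult[OF c] q_inv[OF \<tau>a] by simp
        have cG': "(ginv G (q \<tau>), q \<sigma>) \<in> composable G" using q_composable[OF c] q_inv[OF \<tau>a] by simp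
        have "(q \<tau>, ginv G (q \<tau>)) \<in> composable G" by (rule G.inv_composable[OF q_closed[OF \<tau>a]])
        from G.assoc[OF this cG'] have "(q \<tau>, q ?\<rho>) \<in> composable G" using q\<rho> by simp
        moreover have "q \<sigma> = q \<tau> \<star>\<^bsub>G\<^esub> q ?\<rho>"
          using G.cancel_left[OF cG'] G.inv_inv[OF q_closed[OF \<tau>a]] q\<rho> by simp
        ultimately have "q \<sigma> \<in> D" unfolding D_def using \<tau>(1) XX0 \<rho>s by blast
        then have "q \<sigma> \<in> D \<inter> (arrows G - unit_space G)" using nu \<sigma> by simp
        moreover have "range_of G (q \<sigma>) \<in> W" using True KW q_range[OF \<sigma>] by (metis image_subset_iff)
        moreover have "source_of G (q \<sigma>) \<in> W" using s KW by blast
        ultimately show False using W(4) by blast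
      qed
      ultimately show ?thesis using r(1) by simp
    qed
    finally show ?thesis .
  qed
  then have "conv (tilde X) (conv f (tilde K)) = (\<lambda>\<sigma>\<in>arrows \<Sigma>. f \<sigma>0 \<otimes>\<^bsub>R\<^esub> tilde K \<sigma>)"
    unfolding fK r_def
    by (intro extensionalityI[of _ "arrows \<Sigma>"]) (simp_all add: convolution_def)
  then show ?thesis using that[OF Xo Xc injX K(1,2) Ku] K(3) by blast
qed


section \<open>The kernel of a graded homomorphism\<close>

abbreviation steinberg_algebra :: "('r, 's \<Rightarrow> 'r) module" where
  "steinberg_algebra \<equiv> twisted_steinberg_algebra G R \<Sigma> i q"

lemma zero_steinberg: "(\<lambda>\<sigma>\<in>arrows \<Sigma>. \<zero>\<^bsub>R\<^esub>) \<in> steinberg"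
proof -
  have "(\<lambda>\<sigma>\<in>arrows \<Sigma>. \<zero>\<^bsub>R\<^esub>) = tilde {}" by (auto simp: tilde_indicator_def)
  then show ?thesis using tilde_steinberg[of "{}"] by simp
qed

lemma graded_hom_add:
  assumes \<pi>: "\<pi> \<in> graded_ring_hom \<Gamma> steinberg_algebra Ac Q Qc" and f: "f \<in> steinberg" and g: "g \<in> steinberg"
  shows "\<pi> (\<lambda>\<sigma>\<in>arrows \<Sigma>. f \<sigma> \<oplus>\<^bsub>R\<^esub> g \<sigma>) = \<pi> f \<oplus>\<^bsub>Q\<^esub> \<pi> g"
  using assms unfolding graded_ring_hom_def hom_def by (simp add: twisted_steinberg_algebra_def)

lemma graded_hom_mult:
  assumes \<pi>: "\<pi> \<in> graded_ring_hom \<Gamma> steinberg_algebra Ac Q Qc" and f: "f \<in> steinberg" and g: "g \<in> steinberg"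
  shows "\<pi> (conv f g) = \<pi> f \<otimes>\<^bsub>Q\<^esub> \<pi> g"
  using assms unfolding graded_ring_hom_def hom_def by (simp add: twisted_steinberg_algebra_def)

lemma graded_hom_closed:
  assumes \<pi>: "\<pi> \<in> graded_ring_hom \<Gamma> steinberg_algebra Ac Q Qc" and f: "f \<in> steinberg"
  shows "\<pi> f \<in> carrier Q"
  using assms unfolding graded_ring_hom_def hom_def
  by (auto simp: twisted_steinberg_algebra_def)

lemma graded_hom_zero:
  assumes \<pi>: "\<pi> \<in> graded_ring_hom \<Gamma> steinberg_algebra Ac Q Qc" and Q: "abelian_group Q"
  shows "\<pi> (\<lambda>\<sigma>\<in>arrows \<Sigma>. \<zero>\<^bsub>R\<^esub>) = \<zero>\<^bsub>Q\<^esub>"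
proof -
  interpret Q: abelian_group Q by fact
  let ?z = "\<lambda>\<sigma>\<in>arrows \<Sigma>. \<zero>\<^bsub>R\<^esub>"
  have "(\<lambda>\<sigma>\<in>arrows \<Sigma>. ?z \<sigma> \<oplus>\<^bsub>R\<^esub> ?z \<sigma>) = ?z" by (rule restrict_ext) simp
  then have "\<pi> ?z = \<pi> ?z \<oplus>\<^bsub>Q\<^esub> \<pi> ?z"
    using graded_hom_add[OF \<pi> zero_steinberg zero_steinberg] by simp
  then show ?thesis
    using graded_hom_closed[OF \<pi> zero_steinberg] Q.add.r_cancel_one' by auto
qed

text \<open>
  The homogeneous parts of a kernel element have images in distinct components which sum to zero,
  so directness of the sum in \<open>Q\<close> kills each of them.
\<close>

lemma kernel_homogeneous:
  assumes Q: "graded_ring \<Gamma> Q Qc"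
    and \<pi>: "\<pi> \<in> graded_ring_hom \<Gamma> steinberg_algebra (steinberg_component G R \<Sigma> i q cG) Q Qc"
    and f: "f \<in> steinberg" and ker: "\<pi> f = \<zero>\<^bsub>Q\<^esub>" and \<gamma>: "\<gamma> \<in> carrier \<Gamma>"
  shows "\<pi> (restrict_support (degree_part G cG \<gamma>) f) = \<zero>\<^bsub>Q\<^esub>"
proof -
  interpret Q: graded_ring \<Gamma> Q Qc by fact
  let ?z = "\<lambda>\<sigma>\<in>arrows \<Sigma>. \<zero>\<^bsub>R\<^esub>"
  let ?U = "\<lambda>H. \<Union>\<gamma>\<in>H. degree_part G cG \<gamma>"
  let ?g = "\<lambda>\<gamma>. \<pi> (restrict_support (degree_part G cG \<gamma>) f)"
  have z: "\<pi> ?z = \<zero>\<^bsub>Q\<^esub>" by (rule graded_hom_zero[OF \<pi> Q.abelian_group_axioms])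
  have cutU: "restrict_support (?U H) f \<in> steinberg" for H
    by (rule restrict_support_steinberg[OF f clopen_degree_Union])
  have cut1: "restrict_support (degree_part G cG \<delta>) f \<in> steinberg" for \<delta>
    using cutU[of "{\<delta>}"] by simp
  have gc: "?g \<delta> \<in> carrier Q" for \<delta> by (rule graded_hom_closed[OF \<pi> cut1])
  have gQ: "?g \<delta> \<in> Qc \<delta>" if "\<delta> \<in> carrier \<Gamma>" for \<delta>
  proof -
    have "restrict_support (degree_part G cG \<delta>) f \<in> steinberg_component G R \<Sigma> i q cG \<delta>"
      using cut1 by (simp add: steinberg_component_def suppG_restrict_support)
    then show ?thesis using \<pi> that unfolding graded_ring_hom_def by blast
  qed
  have sum: "\<pi> (restrict_support (?U H) f) = (\<Oplus>\<^bsub>Q\<^esub>\<delta>\<in>H. ?g \<delta>)" if "finite H" for H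
    using that
  proof (induction H rule: finite_induct)
    case empty
    have "restrict_support (?U {}) f = ?z" by (simp add: restrict_support_def)
    then show ?case using z by (simp only: Q.finsum_empty)
  next
    case (insert \<delta> H)
    have "restrict_support (?U (insert \<delta> H)) f =
        (\<lambda>\<sigma>\<in>arrows \<Sigma>. restrict_support (degree_part G cG \<delta>) f \<sigma> \<oplus>\<^bsub>R\<^esub> restrict_support (?U H) f \<sigma>)"
    proof (unfold restrict_support_def[of "?U (insert \<delta> H)"], rule restrict_ext)
      fix \<sigma> assume \<sigma>: "\<sigma> \<in> arrows \<Sigma>"
      show "(if q \<sigma> \<in> ?U (insert \<delta> H) then f \<sigma> else \<zero>\<^bsub>R\<^esub>) =
          restrict_support (degree_part G cG \<delta>) f \<sigma> \<oplus>\<^bsub>R\<^esub> restrict_support (?U H) f \<sigma>"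
        using \<sigma> insert.hyps(2) steinbergD(1)[OF f \<sigma>] by (auto simp: restrict_support_def degree_part_def)
    qed
    then have "\<pi> (restrict_support (?U (insert \<delta> H)) f) = ?g \<delta> \<oplus>\<^bsub>Q\<^esub> \<pi> (restrict_support (?U H) f)"
      using graded_hom_add[OF \<pi> cut1 cutU] by simp
    then show ?case using insert gc by (simp add: Q.finsum_insert Pi_def)
  qed
  let ?F = "cG ` suppG R \<Sigma> q f"
  have F: "finite ?F"
    using image_compactin[OF steinbergD(5)[OF f] continuous_degree]
    by (simp add: compactin_discrete_topology)
  have FG: "?F \<subseteq> carrier \<Gamma>" using degree_closed suppG_subset by blast
  have "restrict_support (?U ?F) f = f"
  proof (rule extensionalityI[of _ "arrows \<Sigma>"])
    fix \<sigma> assume "\<sigma> \<in> arrows \<Sigma>"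
    then show "restrict_support (?U ?F) f \<sigma> = f \<sigma>" by (auto simp: restrict_support_def suppG_def degree_part_def)
  qed (use steinbergD(2)[OF f] in \<open>simp_all add: restrict_support_def\<close>)
  then have sumF: "(\<Oplus>\<^bsub>Q\<^esub>\<delta>\<in>?F. ?g \<delta>) = \<zero>\<^bsub>Q\<^esub>" using sum[OF F] ker by simp
  have off: "?g \<delta> = \<zero>\<^bsub>Q\<^esub>" if "\<delta> \<notin> ?F" for \<delta>
  proof -
    have "f \<sigma> = \<zero>\<^bsub>R\<^esub>" if "\<sigma> \<in> arrows \<Sigma>" "cG (q \<sigma>) = \<delta>" for \<sigma>
      using that \<open>\<delta> \<notin> ?F\<close> unfolding suppG_def by blast
    then have "restrict_support (degree_part G cG \<delta>) f = ?z"
      unfolding restrict_support_def degree_part_def by (intro restrict_ext) simp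
    then show ?thesis using z by simp
  qed
  \<comment> \<open>Compare two families with sum zero: the one restricted to \<open>\<Gamma>\<close> here, and the zero family.\<close>
  define h where "h = (\<lambda>\<delta>\<in>carrier \<Gamma>. ?g \<delta>)"
  let ?H = "{\<delta> \<in> carrier \<Gamma>. h \<delta> \<noteq> \<zero>\<^bsub>Q\<^esub>}"
  have HF: "?H \<subseteq> ?F" using off by (auto simp: h_def)
  have "(\<Oplus>\<^bsub>Q\<^esub>\<delta>\<in>?H. h \<delta>) = (\<Oplus>\<^bsub>Q\<^esub>\<delta>\<in>?F. ?g \<delta>)"
    using FG gc by (intro Q.add.finprod_mono_neutral_cong_left[OF F HF]) (auto simp: h_def)
  then have sumH: "\<zero>\<^bsub>Q\<^esub> = (\<Oplus>\<^bsub>Q\<^esub>\<delta>\<in>?H. h \<delta>)" using sumF by simp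
  have hc: "h \<in> (\<Pi>\<^sub>E \<delta> \<in> carrier \<Gamma>. Qc \<delta>)" using gQ by (simp add: h_def)
  let ?o = "\<lambda>\<delta>\<in>carrier \<Gamma>. \<zero>\<^bsub>Q\<^esub>"
  have oc: "?o \<in> (\<Pi>\<^sub>E \<delta> \<in> carrier \<Gamma>. Qc \<delta>)"
    using subgroup.one_closed[OF Q.component_subgroup] by auto
  have oH: "{\<delta> \<in> carrier \<Gamma>. ?o \<delta> \<noteq> \<zero>\<^bsub>Q\<^esub>} = {}" by auto
  have "h = ?o"
  proof (rule ex1E[OF Q.direct_sum[OF Q.zero_closed]])
    fix k
    assume "\<forall>y. y \<in> (\<Pi>\<^sub>E \<delta> \<in> carrier \<Gamma>. Qc \<delta>) \<and> finite {\<delta> \<in> carrier \<Gamma>. y \<delta> \<noteq> \<zero>\<^bsub>Q\<^esub>} \<and>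
        \<zero>\<^bsub>Q\<^esub> = (\<Oplus>\<^bsub>Q\<^esub>\<delta>\<in>{\<delta> \<in> carrier \<Gamma>. y \<delta> \<noteq> \<zero>\<^bsub>Q\<^esub>}. y \<delta>) \<longrightarrow> y = k"
    then have uniq: "y = k" if "y \<in> (\<Pi>\<^sub>E \<delta> \<in> carrier \<Gamma>. Qc \<delta>)"
        "finite {\<delta> \<in> carrier \<Gamma>. y \<delta> \<noteq> \<zero>\<^bsub>Q\<^esub>}"
        "\<zero>\<^bsub>Q\<^esub> = (\<Oplus>\<^bsub>Q\<^esub>\<delta>\<in>{\<delta> \<in> carrier \<Gamma>. y \<delta> \<noteq> \<zero>\<^bsub>Q\<^esub>}. y \<delta>)" for y
      using that by blast
    have "h = k" by (rule uniq[OF hc finite_subset[OF HF F] sumH])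
    moreover have "?o = k" by (rule uniq) (simp_all only: oc oH finite.emptyI Q.finsum_empty)
    ultimately show "h = ?o" by simp
  qed
  then have "h \<gamma> = ?o \<gamma>" by (rule fun_cong)
  then show ?thesis using \<gamma> by (simp add: h_def)
qed

lemma smult_tilde_steinberg:
  assumes K: "openin (gtop \<Sigma>) K" "compactin (gtop \<Sigma>) K" "inj_on q K" and r: "r \<in> carrier R"
  shows "(\<lambda>\<sigma>\<in>arrows \<Sigma>. r \<otimes>\<^bsub>R\<^esub> tilde K \<sigma>) \<in> steinberg"
  by (rule steinberg_pointwise[OF tilde_steinberg[OF K] tilde_steinberg[OF K], of "\<lambda>a b. r \<otimes>\<^bsub>R\<^esub> a"])
    (use r in \<open>simp_all add: R.m_lcomm R.Units_closed\<close>)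

text \<open>
  A kernel ideal that is not zero contains a nonzero homogeneous element, hence by compression a
  nonzero multiple of the indicator of a set of units.
\<close>

lemma trivial_kernel:
  assumes Q: "graded_ring \<Gamma> Q Qc"
    and \<pi>: "\<pi> \<in> graded_ring_hom \<Gamma> steinberg_algebra (steinberg_component G R \<Sigma> i q cG) Q Qc"
    and faithful: "\<And>K r. openin (gtop \<Sigma>) K \<Longrightarrow> compactin (gtop \<Sigma>) K \<Longrightarrow> K \<subseteq> unit_space \<Sigma> \<Longrightarrow>
      K \<noteq> {} \<Longrightarrow> r \<in> carrier R - {\<zero>\<^bsub>R\<^esub>} \<Longrightarrow>
      \<pi> (\<lambda>\<sigma>\<in>arrows \<Sigma>. r \<otimes>\<^bsub>R\<^esub> tilde K \<sigma>) \<noteq> \<zero>\<^bsub>Q\<^esub>"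
    and f: "f \<in> steinberg" and ker: "\<pi> f = \<zero>\<^bsub>Q\<^esub>" and \<sigma>: "\<sigma> \<in> arrows \<Sigma>"
  shows "f \<sigma> = \<zero>\<^bsub>R\<^esub>"
proof (rule ccontr)
  assume ne: "f \<sigma> \<noteq> \<zero>\<^bsub>R\<^esub>"
  interpret Q: graded_ring \<Gamma> Q Qc by fact
  have null: "\<zero>\<^bsub>Q\<^esub> \<otimes>\<^bsub>Q\<^esub> x = \<zero>\<^bsub>Q\<^esub>" "x \<otimes>\<^bsub>Q\<^esub> \<zero>\<^bsub>Q\<^esub> = \<zero>\<^bsub>Q\<^esub>" if "x \<in> carrier Q" for x
    using Q.l_distr[of "\<zero>\<^bsub>Q\<^esub>" "\<zero>\<^bsub>Q\<^esub>" x] Q.r_distr[of "\<zero>\<^bsub>Q\<^esub>" "\<zero>\<^bsub>Q\<^esub>" x] that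
      Q.m_closed[of "\<zero>\<^bsub>Q\<^esub>" x] Q.m_closed[of x "\<zero>\<^bsub>Q\<^esub>"]
    by (simp_all add: Q.add.r_cancel_one')
  let ?\<gamma> = "cG (q \<sigma>)"
  let ?f = "restrict_support (degree_part G cG ?\<gamma>) f"
  have fs: "?f \<in> steinberg"
    using restrict_support_steinberg[OF f clopen_degree_Union[of "{?\<gamma>}"]] by simp
  have \<pi>f: "\<pi> ?f = \<zero>\<^bsub>Q\<^esub>"
    by (rule kernel_homogeneous[OF Q \<pi> f ker degree_closed[OF q_closed[OF \<sigma>]]])
  have f\<sigma>: "?f \<sigma> = f \<sigma>" using \<sigma> by (simp add: restrict_support_def degree_part_def)
  have "suppG R \<Sigma> q ?f \<subseteq> degree_part G cG ?\<gamma>" by (simp add: suppG_restrict_support)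
  from compress_homogeneous[OF fs this \<sigma>] ne f\<sigma>
  obtain X K where X: "openin (gtop \<Sigma>) X" "compactin (gtop \<Sigma>) X" "inj_on q X"
    and K: "openin (gtop \<Sigma>) K" "compactin (gtop \<Sigma>) K" "K \<subseteq> unit_space \<Sigma>" "K \<noteq> {}"
    and eq: "conv (tilde X) (conv ?f (tilde K)) = (\<lambda>\<sigma>'\<in>arrows \<Sigma>. f \<sigma> \<otimes>\<^bsub>R\<^esub> tilde K \<sigma>')"
    by metis
  have tX: "tilde X \<in> steinberg" by (rule tilde_steinberg[OF X])
  have tK: "tilde K \<in> steinberg"
    using tilde_steinberg[OF K(1,2)] q_inj_units K(3) inj_on_subset by blast
  have fK: "conv ?f (tilde K) \<in> steinberg"
    unfolding convolution_units_right[OF fs K(1-3)]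
    by (rule restrict_support_steinberg[OF fs clopen_source_preimage[OF K(1,2)]])
  have "\<pi> (\<lambda>\<sigma>'\<in>arrows \<Sigma>. f \<sigma> \<otimes>\<^bsub>R\<^esub> tilde K \<sigma>') = \<pi> (tilde X) \<otimes>\<^bsub>Q\<^esub> (\<pi> ?f \<otimes>\<^bsub>Q\<^esub> \<pi> (tilde K))"
    using graded_hom_mult[OF \<pi> tX fK] graded_hom_mult[OF \<pi> fs tK] eq by simp
  also have "\<dots> = \<zero>\<^bsub>Q\<^esub>"
    using \<pi>f null graded_hom_closed[OF \<pi> tX] graded_hom_closed[OF \<pi> tK] by simp
  finally show False using faithful[OF K] ne steinbergD(1)[OF f \<sigma>] by blast
qed

lemma injective_iff_trivial_kernel:
  assumes Q: "abelian_group Q" and \<pi>: "\<pi> \<in> graded_ring_hom \<Gamma> steinberg_algebra Ac Q Qc"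
  shows "inj_on \<pi> steinberg \<longleftrightarrow> (\<forall>f \<in> steinberg. \<pi> f = \<zero>\<^bsub>Q\<^esub> \<longrightarrow> f = (\<lambda>\<sigma>\<in>arrows \<Sigma>. \<zero>\<^bsub>R\<^esub>))"
proof
  assume "inj_on \<pi> steinberg"
  then show "\<forall>f \<in> steinberg. \<pi> f = \<zero>\<^bsub>Q\<^esub> \<longrightarrow> f = (\<lambda>\<sigma>\<in>arrows \<Sigma>. \<zero>\<^bsub>R\<^esub>)"
    using graded_hom_zero[OF \<pi> Q] zero_steinberg by (metis inj_onD)
next
  assume ker: "\<forall>f \<in> steinberg. \<pi> f = \<zero>\<^bsub>Q\<^esub> \<longrightarrow> f = (\<lambda>\<sigma>\<in>arrows \<Sigma>. \<zero>\<^bsub>R\<^esub>)"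
  interpret Q: abelian_group Q by fact
  show "inj_on \<pi> steinberg"
  proof (rule inj_onI)
    fix f g assume f: "f \<in> steinberg" and g: "g \<in> steinberg" and eq: "\<pi> f = \<pi> g"
    let ?d = "\<lambda>\<sigma>\<in>arrows \<Sigma>. f \<sigma> \<ominus>\<^bsub>R\<^esub> g \<sigma>"
    have d: "?d \<in> steinberg"
      by (rule steinberg_pointwise[OF f g])
        (simp_all add: R.minus_eq R.r_distr R.r_minus R.r_neg R.Units_closed)
    have sum: "(\<lambda>\<sigma>\<in>arrows \<Sigma>. ?d \<sigma> \<oplus>\<^bsub>R\<^esub> g \<sigma>) = f"
    proof (rule extensionalityI[of _ "arrows \<Sigma>"])
      fix \<sigma> assume "\<sigma> \<in> arrows \<Sigma>"
      then show "(\<lambda>\<sigma>\<in>arrows \<Sigma>. ?d \<sigma> \<oplus>\<^bsub>R\<^esub> g \<sigma>) \<sigma> = f \<sigma>"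
        using steinbergD(1)[OF f] steinbergD(1)[OF g] by (simp add: R.minus_eq R.a_assoc R.l_neg)
    qed (use steinbergD(2)[OF f] in simp_all)
    then have "\<pi> f = \<pi> ?d \<oplus>\<^bsub>Q\<^esub> \<pi> g" using graded_hom_add[OF \<pi> d g] by simp
    then have "\<pi> ?d = \<zero>\<^bsub>Q\<^esub>"
      using eq graded_hom_closed[OF \<pi> g] graded_hom_closed[OF \<pi> d] Q.add.r_cancel_one by auto
    then have dz: "?d = (\<lambda>\<sigma>\<in>arrows \<Sigma>. \<zero>\<^bsub>R\<^esub>)" using ker d by blast
    show "f = g"
    proof (rule extensionalityI[of _ "arrows \<Sigma>"])
      fix \<sigma> assume \<sigma>: "\<sigma> \<in> arrows \<Sigma>"
      then have "f \<sigma> = ?d \<sigma> \<oplus>\<^bsub>R\<^esub> g \<sigma>" using fun_cong[OF sum, of \<sigma>] by simp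
      also have "?d \<sigma> = \<zero>\<^bsub>R\<^esub>" using fun_cong[OF dz, of \<sigma>] \<sigma> by simp
      finally show "f \<sigma> = g \<sigma>" using steinbergD(1)[OF g \<sigma>] by simp
    qed (use steinbergD(2)[OF f] steinbergD(2)[OF g] in simp_all)
  qed
qed

lemma injective_iff_faithful_on_units:
  assumes Q: "graded_ring \<Gamma> Q Qc"
    and \<pi>: "\<pi> \<in> graded_ring_hom \<Gamma> steinberg_algebra (steinberg_component G R \<Sigma> i q cG) Q Qc"
  shows "inj_on \<pi> steinberg \<longleftrightarrow>
    (\<forall>K. compactin (unit_topology \<Sigma>) K \<and> openin (unit_topology \<Sigma>) K \<and> K \<noteq> {} \<longrightarrow>
       (\<forall>r \<in> carrier R - {\<zero>\<^bsub>R\<^esub>}. \<pi> (\<lambda>\<sigma>\<in>arrows \<Sigma>. r \<otimes>\<^bsub>R\<^esub> tilde K \<sigma>) \<noteq> \<zero>\<^bsub>Q\<^esub>))"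
    (is "_ \<longleftrightarrow> ?faithful")
proof -
  interpret Q: graded_ring \<Gamma> Q Qc by fact
  note inj_iff = injective_iff_trivial_kernel[OF Q.abelian_group_axioms \<pi>]
  show ?thesis
  proof
    assume inj: "inj_on \<pi> steinberg"
    show ?faithful
    proof (intro allI impI ballI notI)
      fix K r
      assume K': "compactin (unit_topology \<Sigma>) K \<and> openin (unit_topology \<Sigma>) K \<and> K \<noteq> {}"
        and r: "r \<in> carrier R - {\<zero>\<^bsub>R\<^esub>}"
        and zero: "\<pi> (\<lambda>\<sigma>\<in>arrows \<Sigma>. r \<otimes>\<^bsub>R\<^esub> tilde K \<sigma>) = \<zero>\<^bsub>Q\<^esub>"
      have K: "openin (gtop \<Sigma>) K" "compactin (gtop \<Sigma>) K" "K \<subseteq> unit_space \<Sigma>"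
        using K' \<Sigma>.openin_unit_topology compactin_subtopology by blast+
      have injK: "inj_on q K" using q_inj_units K(3) by (rule inj_on_subset)
      have Ks: "K \<subseteq> arrows \<Sigma>" using K(1) openin_subset by blast
      obtain k where k: "k \<in> K" using K' by blast
      have "(\<lambda>\<sigma>\<in>arrows \<Sigma>. r \<otimes>\<^bsub>R\<^esub> tilde K \<sigma>) = (\<lambda>\<sigma>\<in>arrows \<Sigma>. \<zero>\<^bsub>R\<^esub>)"
        using inj zero smult_tilde_steinberg[OF K(1,2) injK] r inj_iff by blast
      from fun_cong[OF this, of k] have "r \<otimes>\<^bsub>R\<^esub> tilde K k = \<zero>\<^bsub>R\<^esub>" using k Ks by auto
      then show False using tilde_on[OF Ks injK k] r by simp
    qed
  next
    assume faithful: ?faithful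
    have "f = (\<lambda>\<sigma>\<in>arrows \<Sigma>. \<zero>\<^bsub>R\<^esub>)" if f: "f \<in> steinberg" and ker: "\<pi> f = \<zero>\<^bsub>Q\<^esub>" for f
    proof (rule extensionalityI[of _ "arrows \<Sigma>"])
      fix \<sigma> assume \<sigma>: "\<sigma> \<in> arrows \<Sigma>"
      have "f \<sigma> = \<zero>\<^bsub>R\<^esub>"
      proof (rule trivial_kernel[OF Q \<pi> _ f ker \<sigma>])
        fix K r
        assume "openin (gtop \<Sigma>) K" "compactin (gtop \<Sigma>) K" "K \<subseteq> unit_space \<Sigma>" "K \<noteq> {}"
          "r \<in> carrier R - {\<zero>\<^bsub>R\<^esub>}"
        then show "\<pi> (\<lambda>\<sigma>\<in>arrows \<Sigma>. r \<otimes>\<^bsub>R\<^esub> tilde K \<sigma>) \<noteq> \<zero>\<^bsub>Q\<^esub>"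
          using faithful by (simp add: \<Sigma>.openin_unit_topology compactin_subtopology)
      qed
      then show "f \<sigma> = (\<lambda>\<sigma>\<in>arrows \<Sigma>. \<zero>\<^bsub>R\<^esub>) \<sigma>" using \<sigma> by simp
    qed (use steinbergD(2)[OF f] in simp_all)
    then show "inj_on \<pi> steinberg" using inj_iff by blast
  qed
qed

end

theorem corollary4p4:
  fixes G :: "('g, 'm) groupoid_scheme" and R :: "('r, 'n) ring_scheme"
    and \<Sigma> :: "('s, 'k) groupoid_scheme" and i :: "'g \<times> 'r \<Rightarrow> 's" and q :: "'s \<Rightarrow> 'g"
    and \<Gamma> :: "('c, 'l) monoid_scheme" and cG :: "'g \<Rightarrow> 'c" and c\<Sigma> :: "'s \<Rightarrow> 'c"
    and Q :: "('q, 'p) ring_scheme" and Qc :: "'c \<Rightarrow> 'q set" and \<pi> :: "('s \<Rightarrow> 'r) \<Rightarrow> 'q"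
  assumes "ample_groupoid G" and "Hausdorff_space (gtop G)"
    and "cring R" and "group \<Gamma>"
    and "graded_discrete_twist G R \<Sigma> i q \<Gamma> cG c\<Sigma>"
    and "effective (restrict_groupoid G (degree_part G cG \<one>\<^bsub>\<Gamma>\<^esub>))"
    and "graded_ring \<Gamma> Q Qc"
    and "\<pi> \<in> graded_ring_hom \<Gamma> (twisted_steinberg_algebra G R \<Sigma> i q)
           (steinberg_component G R \<Sigma> i q cG) Q Qc"
  shows "inj_on \<pi> (carrier (twisted_steinberg_algebra G R \<Sigma> i q)) \<longleftrightarrow>
    (\<forall>K. compactin (unit_topology \<Sigma>) K \<and> openin (unit_topology \<Sigma>) K \<and> K \<noteq> {} \<longrightarrow>
       (\<forall>r \<in> carrier R - {\<zero>\<^bsub>R\<^esub>}.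
          \<pi> (r \<odot>\<^bsub>twisted_steinberg_algebra G R \<Sigma> i q\<^esub> tilde_indicator R \<Sigma> i q K) \<noteq> \<zero>\<^bsub>Q\<^esub>))"
proof -
  interpret graded_discrete_twist G R \<Sigma> i q \<Gamma> cG c\<Sigma> by fact
  interpret effective_graded_twist G R \<Sigma> i q \<Gamma> cG c\<Sigma>
    using assms(1-6)
    by (intro effective_graded_twist.intro ample_twist.intro ample_twist_axioms.intro
        effective_graded_twist_axioms.intro discrete_twist_axioms)
  show ?thesis
    using injective_iff_faithful_on_units[OF assms(7,8)]
    by (simp add: twisted_steinberg_algebra_def)
qed

end
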